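(* There is an absolute constant $C>0$ such that for every $d\in\mathbb{N}=\{1,2,3,\dots\}$ $$\mathrm{BH}_{\{\pm1\}}^{\le d}\le C^{\sqrt{d\log d}}.$$ That is, for all $d,n\in\mathbb{N}$ and every function $f:\{\pm1\}^n\to\mathbb{R}$ of degree at most $d$, $$\Big(\sum_{S\subset[n],\,|S|\le d}|\widehat f(S)|^{\frac{2d}{d+1}}\Big)^{\frac{d+1}{2d}}\le C^{\sqrt{d\log d}}\,\max_{x\in\{\pm1\}^n}|f(x)|.$$ In particular, $\limsup_{d\to\infty}\sqrt[d]{\mathrm{BH}_{\{\pm1\}}^{\le d}}=1$.
   Context: Write $[n]=\{1,\dots,n\}$. Every function $f:\{\pm1\}^n\to\mathbb{R}$ has a unique Fourier-Walsh expansion $f(x)=\sum_{S\subset[n]}\widehat f(S)\,x^S$, where $x^S=\prod_{k\in S}x_k$ (with $x^\emptyset=1$) and $\widehat f(S)=2^{-n}\sum_{x\in\{\pm1\}^n}f(x)x^S$. The function $f$ has degree at most $d$ if $\widehat f(S)=0$ whenever $|S|>d$. $\mathrm{BH}_{\{\pm1\}}^{\le d}$ denotes the best (smallest) constant $C(d)$ such that for every $n\in\mathbb{N}$ and every $f:\{\pm1\}^n\to\mathbb{R}$ of degree at most $d$ one has $\big(\sum_{|S|\le d}|\widehat f(S)|^{2d/(d+1)}\big)^{(d+1)/(2d)}\le C(d)\,\max_{x\in\{\pm1\}^n}|f(x)|$. The logarithm is the natural logarithm. *)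

theory Defs
  imports Complex_Main "HOL-Library.FuncSet" "HOL-Library.Extended_Real"
begin

text \<open>
  A function on the discrete cube is represented by \<open>f :: (nat \<Rightarrow> real) \<Rightarrow> real\<close>,
  of which only the values on \<open>cube n\<close> are ever used.
\<close>

definition cube :: "nat \<Rightarrow> (nat \<Rightarrow> real) set" where
  "cube n = {1..n} \<rightarrow>\<^sub>E {- 1, 1}"

definition walsh :: "nat set \<Rightarrow> (nat \<Rightarrow> real) \<Rightarrow> real" where
  "walsh S x = (\<Prod>k\<in>S. x k)"

definition fourier_coeff :: "nat \<Rightarrow> ((nat \<Rightarrow> real) \<Rightarrow> real) \<Rightarrow> nat set \<Rightarrow> real" where
  "fourier_coeff n f S = (\<Sum>x\<in>cube n. f x * walsh S x) / 2 ^ n"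

definition degree_at_most :: "nat \<Rightarrow> nat \<Rightarrow> ((nat \<Rightarrow> real) \<Rightarrow> real) \<Rightarrow> bool" where
  "degree_at_most n d f \<longleftrightarrow> (\<forall>S. S \<subseteq> {1..n} \<and> card S > d \<longrightarrow> fourier_coeff n f S = 0)"

definition coeff_norm :: "nat \<Rightarrow> nat \<Rightarrow> ((nat \<Rightarrow> real) \<Rightarrow> real) \<Rightarrow> real" where
  "coeff_norm n d f =
     (\<Sum>S\<in>{S. S \<subseteq> {1..n} \<and> card S \<le> d}.
        \<bar>fourier_coeff n f S\<bar> powr (2 * real d / (real d + 1)))
     powr ((real d + 1) / (2 * real d))"

definition cube_sup_norm :: "nat \<Rightarrow> ((nat \<Rightarrow> real) \<Rightarrow> real) \<Rightarrow> real" where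
  "cube_sup_norm n f = Max ((\<lambda>x. \<bar>f x\<bar>) ` cube n)"

definition BH_bound :: "nat \<Rightarrow> real \<Rightarrow> bool" where
  "BH_bound d K \<longleftrightarrow>
     (\<forall>n\<ge>1. \<forall>f. degree_at_most n d f \<longrightarrow> coeff_norm n d f \<le> K * cube_sup_norm n f)"

text \<open>
  On the reals, \<open>LEAST\<close> is unspecified if no least element exists, so an upper bound on
  \<open>BH d\<close> alone does not yield \<open>BH_bound\<close>; the inequality for functions has to be
  asserted separately.
\<close>

definition BH :: "nat \<Rightarrow> real" where
  "BH d = (LEAST K. BH_bound d K)"

end

theory Submission
  imports Defs "HOL-Complex_Analysis.Complex_Analysis" "HOL-Real_Asymp.Real_Asymp"
begin

text \<open>
  Let \<open>f\<close> have degree at most \<open>d\<close>, sup norm at most \<open>1\<close> and coefficients \<open>a S\<close>, and write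
  \<open>p k = 2k/(k+1)\<close>. Splitting each \<open>S\<close> into blocks whose prescribed sizes \<open>k\<close> add up to \<open>d\<close>, a
  Blei-type inequality bounds the \<open>p d\<close>-sum of \<open>a\<close> by the quantities
  \<open>\<Sum>T. (\<Sum>S\<supseteq>T. (a S)\<^sup>2) powr (p k / 2)\<close> over \<open>card T \<le> k\<close>.
  The inner sum is, up to a constant, the squared \<open>L\<^sup>2\<close> norm of \<open>x \<mapsto> D\<^sub>T f (\<rho> x)\<close> with
  \<open>\<rho> = d/(d+1)\<close>, and interpolating the fourth moment bound of Bonami replaces \<open>L\<^sup>2\<close> by
  \<open>L\<^sup>p\<close>, \<open>p = p k\<close>, at the cost of a factor \<open>9 powr (d/(k+1))\<close>. For fixed \<open>x\<close>, the numbers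
  \<open>D\<^sub>T f (\<rho> x)\<close> are the coefficients in \<open>y\<close> of the part of degree at most \<open>k\<close> in the Taylor
  expansion of \<open>f\<close> at \<open>\<rho> x\<close>. Since \<open>\<rho> x + t (1-\<rho>) y\<close> stays in the solid cube for
  \<open>\<bar>t\<bar> \<le> 1\<close>, a bound for the coefficients of a polynomial on \<open>[-1, 1]\<close> shows that this part is at
  most \<open>d powr O(k)\<close>, so the inequality for degree \<open>k\<close> applies to it. Blocks of size \<open>1\<close> give a
  constant exponential in \<open>d\<close>; using that constant for blocks of size about \<open>sqrt (d / ln d)\<close> gives
  the theorem.
\<close>

section \<open>Coefficients of polynomials bounded on an interval\<close>

text \<open>Cauchy's estimate for the \<open>k\<close>-th derivative at \<open>0\<close>, which is
  \<open>fact k\<close> times the coefficient.\<close>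

lemma coeff_le_of_bound_on_circle:
  fixes p :: "complex poly"
  assumes "r > 0" and bound: "\<And>z. norm z = r \<Longrightarrow> norm (poly p z) \<le> B"
  shows "norm (coeff p k) \<le> B / r ^ k"
proof -
  have der: "(deriv ^^ k) (poly p) = poly ((pderiv ^^ k) p)"
  proof (induction k)
    case (Suc k)
    then show ?case
      by (auto intro!: ext DERIV_imp_deriv poly_DERIV)
  qed auto
  have "(deriv ^^ k) (poly p) 0 = fact k * coeff p k"
    by (simp add: der poly_0_coeff_0 coeff_higher_pderiv pochhammer_fact)
  moreover have "norm ((deriv ^^ k) (poly p) 0) \<le> fact k * B / r ^ k"
    by (rule Cauchy_inequality) (use assms in \<open>auto intro!: holomorphic_intros continuous_intros\<close>)
  ultimately have "fact k * norm (coeff p k) \<le> fact k * (B / r ^ k)"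
    by (simp add: norm_mult)
  then show ?thesis
    by (rule mult_left_le_imp_le) simp
qed

text \<open>
  The Joukowski substitution \<open>w = (z + 1/z) / 2\<close> maps the unit circle onto \<open>[-1, 1]\<close>, and
  \<open>z^d p(w)\<close> is a polynomial in \<open>z\<close>, so that the maximum principle applies to it.
\<close>
lemma norm_poly_le_near_interval:
  fixes c :: "nat \<Rightarrow> real" and w :: complex
  assumes bound: "\<And>t. \<bar>t\<bar> \<le> 1 \<Longrightarrow> \<bar>\<Sum>j\<le>d. c j * t ^ j\<bar> \<le> M"
  shows "norm (\<Sum>j\<le>d. of_real (c j) * w ^ j) \<le> M * (1 + 2 * norm w) ^ d"
proof -
  define q where "q z = (\<Sum>j\<le>d. of_real (c j) * ((z\<^sup>2 + 1) / 2) ^ j * z ^ (d - j))" for z :: complex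
  \<comment> \<open>The hypothesis says \<open>v = (z + 1/z) / 2\<close> with the denominator
    cleared, so that \<open>z = 0\<close> does no harm.\<close>
  have q: "q z = z ^ d * (\<Sum>j\<le>d. of_real (c j) * v ^ j)" if "z\<^sup>2 + 1 = 2 * v * z" for z v
  proof -
    have "((z\<^sup>2 + 1) / 2) ^ j * z ^ (d - j) = z ^ d * v ^ j" if "j \<le> d" for j
    proof -
      have "z ^ d = z ^ j * z ^ (d - j)"
        using that by (simp flip: power_add)
      then show ?thesis
        using \<open>z\<^sup>2 + 1 = 2 * v * z\<close> by (simp add: power_mult_distrib)
    qed
    then show ?thesis
      unfolding q_def sum_distrib_left by (intro sum.cong) (auto simp: algebra_simps)
  qed
  have M: "M \<ge> 0"
    using bound[of 0] by linarith
  \<comment> \<open>On the unit circle \<open>1/z\<close> is \<open>cnj z\<close>, so the Joukowski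
    image of \<open>z\<close> is the real number \<open>Re z\<close>.\<close>
  have q_circle: "norm (q z) \<le> M" if "norm z = 1" for z
  proof -
    have "z * cnj z = 1"
      using that by (simp add: complex_norm_square[symmetric])
    moreover have "z + cnj z = 2 * of_real (Re z)"
      by (simp add: complex_add_cnj)
    ultimately have "z\<^sup>2 + 1 = 2 * of_real (Re z) * z"
      by (metis (no_types) distrib_left mult.commute power2_eq_square)
    then have "norm (q z) = norm (\<Sum>j\<le>d. complex_of_real (c j) * of_real (Re z) ^ j)"
      using that by (subst q) (auto simp: norm_mult norm_power)
    also have "\<dots> = \<bar>\<Sum>j\<le>d. c j * Re z ^ j\<bar>"
      by (metis (no_types, lifting) norm_of_real of_real_mult of_real_power of_real_sum sum.cong)
    also have "\<dots> \<le> M"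
      using that abs_Re_le_cmod[of z] by (intro bound) simp
    finally show ?thesis .
  qed
  have q_disc: "norm (q z) \<le> M" if "norm z \<le> 1" for z
  proof (rule maximum_modulus_frontier[where S = "cball 0 1" and f = q and \<xi> = z])
    show "q holomorphic_on interior (cball 0 1)" "continuous_on (closure (cball 0 1)) q"
      unfolding q_def by (auto intro!: holomorphic_intros continuous_intros)
  qed (use that q_circle in auto)
  \<comment> \<open>The preimages of \<open>w\<close> are the roots \<open>w + s\<close> and
    \<open>w - s\<close> of \<open>z^2 - 2 w z + 1\<close>. Their product is \<open>1\<close>, so
    one of them lies in the closed unit disc.\<close>
  define s where "s = csqrt (w\<^sup>2 - 1)"
  have s: "s\<^sup>2 = w\<^sup>2 - 1"
    by (simp add: s_def)
  have prod1: "(w + s) * (w - s) = 1"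
    using s by (simp add: algebra_simps power2_eq_square)
  have norms: "norm (w + s) * norm (w - s) = 1"
    using prod1 by (metis norm_mult norm_one)
  obtain z z' where zz: "z * z' = 1" "z + z' = 2 * w" "norm z \<le> 1"
  proof (cases "norm (w + s) \<le> 1")
    case True
    then show ?thesis using that[of "w + s" "w - s"] prod1 by simp
  next
    case False
    then have "norm (w - s) \<le> 1"
      using norms by (smt (verit) mult_less_cancel_left2 norm_ge_zero mult_le_cancel_right1)
    then show ?thesis using that[of "w - s" "w + s"] prod1 by (simp add: mult.commute)
  qed
  have z0: "z \<noteq> 0"
    using zz by auto
  have inv: "norm z' = 1 / norm z"
    using zz z0 by (metis nonzero_eq_divide_eq norm_eq_zero norm_mult norm_one mult.commute)
  \<comment> \<open>Since \<open>p(w) = q z / z^d\<close>, leaving the interval costs the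
    \<open>d\<close>-th power of \<open>norm z' = 1 / norm z\<close>.\<close>
  have "norm z' \<le> norm (2 * w) + norm z"
    using zz by (metis add_diff_cancel_left' norm_triangle_ineq4)
  then have le: "norm z' \<le> 1 + 2 * norm w"
    using zz by (simp add: norm_mult)
  have "q z = z ^ d * (\<Sum>j\<le>d. of_real (c j) * w ^ j)"
    using zz by (intro q) (metis distrib_left mult.commute power2_eq_square)
  then have "norm (\<Sum>j\<le>d. of_real (c j) * w ^ j) = norm (q z) * norm z' ^ d"
    using z0 by (simp add: inv norm_mult norm_power field_simps)
  also have "\<dots> \<le> M * (1 + 2 * norm w) ^ d"
    using q_disc zz le M by (intro mult_mono power_mono) auto
  finally show ?thesis .
qed

lemma one_plus_inverse_power_le: "(1 + 1 / real d) ^ d \<le> 3"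
proof (cases "d = 0")
  case False
  then have "(1 + 1 / real d) ^ d \<le> exp 1"
    using exp_ge_one_plus_x_over_n_power_n[of d 1] by simp
  also have "\<dots> \<le> 3"
    by (rule exp_le)
  finally show ?thesis .
qed simp

text \<open>On the circle of radius \<open>1 / (2 * real d)\<close> the growth factor is
  \<open>(1 + 1 / real d) ^ d\<close>, at most \<open>3\<close>. Only the \<open>k\<close>-th power
  of the radius remains, so low coefficients cost \<open>d\<close> to a power of order
  \<open>k\<close> and nothing exponential in \<open>d\<close>.\<close>

lemma coeff_le_of_bound_on_interval:
  fixes c :: "nat \<Rightarrow> real"
  assumes "\<And>t. \<bar>t\<bar> \<le> 1 \<Longrightarrow> \<bar>\<Sum>j\<le>d. c j * t ^ j\<bar> \<le> M" and "d \<ge> 1" "k \<le> d"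
  shows "\<bar>c k\<bar> \<le> 3 * M * (2 * real d) ^ k"
proof -
  define p where "p = (\<Sum>j\<le>d. monom (complex_of_real (c j)) j)"
  define r where "r = 1 / (2 * real d)"
  have M: "M \<ge> 0"
    using assms(1)[of 0] by linarith
  have p: "poly p z = (\<Sum>j\<le>d. of_real (c j) * z ^ j)" for z
    by (simp add: p_def poly_sum poly_monom)
  have "norm (coeff p k) \<le> (M * 3) / r ^ k"
  proof (rule coeff_le_of_bound_on_circle)
    fix z :: complex assume z: "norm z = r"
    have "norm (poly p z) \<le> M * (1 + 2 * norm z) ^ d"
      unfolding p by (rule norm_poly_le_near_interval) (rule assms)
    also have "\<dots> = M * (1 + 1 / real d) ^ d"
      by (simp add: z r_def)
    also have "\<dots> \<le> M * 3"
      using one_plus_inverse_power_le M by (intro mult_left_mono)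
    finally show "norm (poly p z) \<le> M * 3" .
  qed (use assms in \<open>simp add: r_def\<close>)
  moreover have "coeff p k = of_real (c k)"
    using assms by (simp add: p_def coeff_sum)
  ultimately show ?thesis
    using assms by (simp add: r_def power_divide field_simps)
qed

section \<open>Walsh sums and hypercontractivity\<close>

text \<open>The variables form an arbitrary set, so that inductions can add them one at a
  time.\<close>

definition hypercube :: "nat set \<Rightarrow> (nat \<Rightarrow> real) set" where
  "hypercube V = V \<rightarrow>\<^sub>E {- 1, 1}"

definition mean :: "nat set \<Rightarrow> ((nat \<Rightarrow> real) \<Rightarrow> real) \<Rightarrow> real" where
  "mean V g = (\<Sum>x\<in>hypercube V. g x) / 2 ^ card V"

text \<open>Off the cube this is the multilinear extension, which the Taylor expansion and the solid
  cube rely on.\<close>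

definition walsh_sum :: "nat set \<Rightarrow> (nat set \<Rightarrow> real) \<Rightarrow> (nat \<Rightarrow> real) \<Rightarrow> real" where
  "walsh_sum V a x = (\<Sum>S\<in>Pow V. a S * walsh S x)"

definition degree_le :: "nat \<Rightarrow> nat set \<Rightarrow> (nat set \<Rightarrow> real) \<Rightarrow> bool" where
  "degree_le d V a \<longleftrightarrow> (\<forall>S. S \<subseteq> V \<longrightarrow> card S > d \<longrightarrow> a S = 0)"

section \<open>Averages over the cube, Parseval and Bonami's fourth moment bound\<close>

lemma finite_hypercube [simp]: "finite V \<Longrightarrow> finite (hypercube V)"
  unfolding hypercube_def by (intro finite_PiE) auto

lemma card_hypercube: "finite V \<Longrightarrow> card (hypercube V) = 2 ^ card V"
  unfolding hypercube_def by (subst card_PiE) (auto simp: numeral_2_eq_2)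

lemma hypercube_insert:
  assumes "finite V" "i \<notin> V"
  shows "(\<Sum>x\<in>hypercube (insert i V). g x) = (\<Sum>x\<in>hypercube V. g (x(i := 1)) + g (x(i := - 1)))"
    (is "?l = ?r")
proof -
  have inj: "inj_on (\<lambda>(e, x). x(i := e)) ({- 1, 1} \<times> hypercube V)"
    unfolding hypercube_def by (rule inj_combinator) fact
  have "?l = (\<Sum>(e, x)\<in>{- 1, 1} \<times> hypercube V. g (x(i := e)))"
    unfolding hypercube_def PiE_insert_eq
    using inj unfolding hypercube_def by (subst sum.reindex) (auto simp: case_prod_beta)
  also have "\<dots> = ?r"
    by (subst sum.cartesian_product[symmetric]) (simp add: sum.distrib add.commute)
  finally show ?thesis .
qed

lemma mean_insert:
  assumes "finite V" "i \<notin> V"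
  shows "mean (insert i V) g = mean V (\<lambda>x. (g (x(i := 1)) + g (x(i := - 1))) / 2)"
  using assms by (simp add: mean_def hypercube_insert flip: sum_divide_distrib)

lemma mean_empty [simp]: "mean {} g = g (\<lambda>_. undefined)"
  by (simp add: mean_def hypercube_def)

lemma mean_add: "mean V (\<lambda>x. f x + g x) = mean V f + mean V g"
  by (simp add: mean_def sum.distrib add_divide_distrib)

lemma mean_cmult: "mean V (\<lambda>x. c * f x) = c * mean V f"
  by (simp add: mean_def flip: sum_distrib_left)

lemma mean_sum: "mean V (\<lambda>x. \<Sum>i\<in>I. f i x) = (\<Sum>i\<in>I. mean V (f i))"
  unfolding mean_def by (subst sum.swap) (simp add: sum_divide_distrib)

lemma mean_const [simp]: "finite V \<Longrightarrow> mean V (\<lambda>_. c) = c"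
  by (simp add: mean_def card_hypercube)

lemma mean_mono: "(\<And>x. x \<in> hypercube V \<Longrightarrow> f x \<le> g x) \<Longrightarrow> mean V f \<le> mean V g"
  unfolding mean_def by (intro divide_right_mono sum_mono) auto

lemma mean_nonneg: "(\<And>x. x \<in> hypercube V \<Longrightarrow> 0 \<le> f x) \<Longrightarrow> 0 \<le> mean V f"
  unfolding mean_def by (intro divide_nonneg_nonneg sum_nonneg) auto

lemma mean_Cauchy_Schwarz: "(mean V (\<lambda>x. f x * g x))\<^sup>2 \<le> mean V (\<lambda>x. (f x)\<^sup>2) * mean V (\<lambda>x. (g x)\<^sup>2)"
  using Cauchy_Schwarz_ineq_sum[of f g "hypercube V"]
  by (simp add: mean_def power_divide divide_right_mono flip: power2_eq_square)

lemma walsh_fun_upd [simp]: "i \<notin> S \<Longrightarrow> walsh S (x(i := e)) = walsh S x"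
  unfolding walsh_def by (intro prod.cong) auto

lemma inj_on_insert_Pow: "i \<notin> V \<Longrightarrow> inj_on (insert i) (Pow V)"
  by (rule inj_onI) (metis PowD insert_ident subsetD)

text \<open>A Walsh sum is affine in each coordinate; the slope is its derivative in direction
  \<open>i\<close>. The inductions on the number of variables rest on this.\<close>

lemma walsh_sum_insert:
  assumes "finite V" "i \<notin> V"
  shows "walsh_sum (insert i V) a (x(i := e)) = walsh_sum V a x + e * walsh_sum V (\<lambda>S. a (insert i S)) x"
proof -
  have inj: "inj_on (insert i) (Pow V)"
    using assms(2) by (rule inj_on_insert_Pow)
  have w: "walsh (insert i S) (x(i := e)) = e * walsh S x" if "S \<subseteq> V" for S
  proof -
    have "finite S" "i \<notin> S"
      using that assms finite_subset by auto
    then have "walsh (insert i S) (x(i := e)) = e * walsh S (x(i := e))"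
      by (simp add: walsh_def)
    then show ?thesis
      using \<open>i \<notin> S\<close> by simp
  qed
  have "walsh_sum (insert i V) a (x(i := e)) =
      (\<Sum>S\<in>Pow V. a S * walsh S (x(i := e))) + (\<Sum>S\<in>Pow V. a (insert i S) * walsh (insert i S) (x(i := e)))"
    unfolding walsh_sum_def Pow_insert using assms inj
    by (subst sum.union_disjoint) (auto simp: sum.reindex)
  also have "(\<Sum>S\<in>Pow V. a S * walsh S (x(i := e))) = walsh_sum V a x"
    unfolding walsh_sum_def using assms(2) by (intro sum.cong) (auto simp del: mult_cancel_left intro!: arg_cong2[where f = "(*)"] walsh_fun_upd)
  also have "(\<Sum>S\<in>Pow V. a (insert i S) * walsh (insert i S) (x(i := e))) = e * walsh_sum V (\<lambda>S. a (insert i S)) x"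
    unfolding walsh_sum_def sum_distrib_left by (intro sum.cong) (auto simp: w)
  finally show ?thesis .
qed

lemma degree_le_insert:
  assumes "degree_le d (insert i V) a"
  shows "degree_le d V a"
  using assms by (auto simp: degree_le_def)

lemma degree_le_insert_Suc:
  assumes "degree_le (Suc d) (insert i V) a" "finite V" "i \<notin> V"
  shows "degree_le d V (\<lambda>S. a (insert i S))"
  unfolding degree_le_def
proof (intro allI impI)
  fix S assume S: "S \<subseteq> V" "d < card S"
  then have "card (insert i S) = Suc (card S)"
    using assms by (auto intro!: card_insert_disjoint intro: finite_subset)
  then have "insert i S \<subseteq> insert i V" "card (insert i S) > Suc d"
    using S by auto
  then show "a (insert i S) = 0"
    using assms(1) unfolding degree_le_def by blast
qed

text \<open>Parseval: averaging over the sign of one variable removes the cross term.\<close>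

lemma mean_walsh_sum_square:
  assumes "finite V"
  shows "mean V (\<lambda>x. (walsh_sum V a x)\<^sup>2) = (\<Sum>S\<in>Pow V. (a S)\<^sup>2)"
  using assms
proof (induction V arbitrary: a rule: finite_induct)
  case empty
  then show ?case by (simp add: walsh_sum_def walsh_def)
next
  case (insert i V)
  have inj: "inj_on (insert i) (Pow V)"
    using insert(2) by (rule inj_on_insert_Pow)
  define b where "b = (\<lambda>S. a (insert i S))"
  have "mean (insert i V) (\<lambda>x. (walsh_sum (insert i V) a x)\<^sup>2) =
      mean V (\<lambda>x. (walsh_sum V a x)\<^sup>2 + (walsh_sum V b x)\<^sup>2)"
    using insert(1,2)
    by (subst mean_insert) (auto simp: walsh_sum_insert b_def power2_sum power2_diff add_divide_distrib)
  also have "\<dots> = (\<Sum>S\<in>Pow V. (a S)\<^sup>2) + (\<Sum>S\<in>Pow V. (b S)\<^sup>2)"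
    by (simp add: mean_add insert.IH)
  also have "\<dots> = (\<Sum>S\<in>Pow (insert i V). (a S)\<^sup>2)"
    unfolding Pow_insert b_def using insert(1,2) inj
    by (subst sum.union_disjoint) (auto simp: sum.reindex)
  finally show ?case .
qed

text \<open>Write the function as \<open>g + x i * h\<close>. Odd powers of \<open>x i\<close>
  average to zero, Cauchy-Schwarz handles the mixed term, and \<open>h\<close> has one degree less,
  which gains a factor \<open>9\<close>.\<close>

lemma Bonami_4:
  assumes "finite V" "degree_le d V a"
  shows "mean V (\<lambda>x. walsh_sum V a x ^ 4) \<le> 9 ^ d * (mean V (\<lambda>x. (walsh_sum V a x)\<^sup>2))\<^sup>2"
  using assms
proof (induction V arbitrary: a d rule: finite_induct)
  case empty
  have "walsh_sum {} a (\<lambda>_. undefined) ^ 4 \<le> 9 ^ d * ((walsh_sum {} a (\<lambda>_. undefined))\<^sup>2)\<^sup>2"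
    by (simp add: power_mult[symmetric] mult_le_cancel_right1 not_less)
  then show ?case by simp
next
  case (insert i V)
  define b where "b = (\<lambda>S. a (insert i S))"
  define g h where "g = walsh_sum V a" and "h = walsh_sum V b"
  define G H where "G = mean V (\<lambda>x. (g x)\<^sup>2)" and "H = mean V (\<lambda>x. (h x)\<^sup>2)"
  have GH: "G \<ge> 0" "H \<ge> 0"
    unfolding G_def H_def by (auto intro: mean_nonneg)
  have upd: "walsh_sum (insert i V) a (x(i := e)) = g x + e * h x" for x e
    using insert(1,2) by (simp add: walsh_sum_insert g_def h_def b_def)
  have sq: "mean (insert i V) (\<lambda>x. (walsh_sum (insert i V) a x)\<^sup>2) = G + H"
  proof -
    have "((g x + 1 * h x)\<^sup>2 + (g x + - 1 * h x)\<^sup>2) / 2 = (g x)\<^sup>2 + (h x)\<^sup>2" for x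
      by (simp add: power2_eq_square algebra_simps)
    then show ?thesis
      unfolding mean_insert[OF insert(1,2)] upd by (simp only: mean_add G_def H_def)
  qed
  have "((g x + 1 * h x) ^ 4 + (g x + - 1 * h x) ^ 4) / 2 = g x ^ 4 + 6 * ((g x)\<^sup>2 * (h x)\<^sup>2) + h x ^ 4" for x
    by (simp add: power2_eq_square power4_eq_xxxx algebra_simps)
  then have four: "mean (insert i V) (\<lambda>x. walsh_sum (insert i V) a x ^ 4) =
      mean V (\<lambda>x. g x ^ 4) + 6 * mean V (\<lambda>x. (g x)\<^sup>2 * (h x)\<^sup>2) + mean V (\<lambda>x. h x ^ 4)"
    unfolding mean_insert[OF insert(1,2)] upd by (simp only: mean_add mean_cmult)
  have g4: "mean V (\<lambda>x. g x ^ 4) \<le> 9 ^ d * G\<^sup>2"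
    unfolding g_def G_def using degree_le_insert[OF insert.prems] by (rule insert.IH)
  show ?case
  proof (cases d)
    \<comment> \<open>The degree of \<open>h\<close> cannot drop below \<open>0\<close>; here
      \<open>h\<close> itself vanishes.\<close>
    case 0
    have "b S = 0" if "S \<subseteq> V" for S
    proof -
      have "card (insert i S) > 0"
        using that insert(1) finite_subset by (subst card_gt_0_iff) auto
      then show ?thesis
        using insert.prems that 0 unfolding degree_le_def b_def by blast
    qed
    then have h0: "h = (\<lambda>_. 0)"
      by (auto simp: h_def walsh_sum_def intro!: sum.neutral)
    then show ?thesis
      using g4 insert(1) unfolding sq four by (simp add: H_def)
  next
    case (Suc e)
    have h4: "mean V (\<lambda>x. h x ^ 4) \<le> 9 ^ e * H\<^sup>2"
      unfolding h_def H_def b_def using insert.prems insert(1,2) Suc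
      by (intro insert.IH degree_le_insert_Suc[of _ i]) auto
    have "(mean V (\<lambda>x. (g x)\<^sup>2 * (h x)\<^sup>2))\<^sup>2 \<le> mean V (\<lambda>x. g x ^ 4) * mean V (\<lambda>x. h x ^ 4)"
      using mean_Cauchy_Schwarz[of V "\<lambda>x. (g x)\<^sup>2" "\<lambda>x. (h x)\<^sup>2"] by (simp flip: power_mult)
    also have "\<dots> \<le> (9 ^ d * G\<^sup>2) * (9 ^ e * H\<^sup>2)"
      using g4 h4 by (intro mult_mono) (auto intro!: mean_nonneg)
    also have "\<dots> = (3 * 9 ^ e * (G * H))\<^sup>2"
      by (simp add: Suc power2_eq_square)
    finally have gh: "mean V (\<lambda>x. (g x)\<^sup>2 * (h x)\<^sup>2) \<le> 3 * 9 ^ e * (G * H)"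
      by (rule power2_le_imp_le) (use GH in auto)
    have "mean (insert i V) (\<lambda>x. walsh_sum (insert i V) a x ^ 4) \<le>
        9 ^ d * G\<^sup>2 + 6 * (3 * 9 ^ e * (G * H)) + 9 ^ e * H\<^sup>2"
      unfolding four using g4 gh h4 by linarith
    \<comment> \<open>\<open>6 * 3 * 9 ^ e\<close> equals \<open>2 * 9 ^ d\<close>, exactly the
      cross term on the right; this explains the base \<open>9\<close>.\<close>
    also have "\<dots> \<le> 9 ^ d * (G + H)\<^sup>2"
      using GH by (simp add: Suc power2_sum algebra_simps)
    finally show ?thesis
      unfolding sq .
  qed
qed

section \<open>Hoelder's inequality and comparison of moments\<close>

lemma Young_powr:
  fixes a b :: real
  assumes "0 < \<alpha>" "\<alpha> < 1" "a \<ge> 0" "b \<ge> 0"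
  shows "a powr \<alpha> * b powr (1 - \<alpha>) \<le> \<alpha> * a + (1 - \<alpha>) * b"
proof (cases "a = 0 \<or> b = 0")
  case False
  then show ?thesis
    using assms by (intro Youngs_inequality_0) auto
qed (use assms in auto)

text \<open>Young's inequality termwise, after normalising both sums to \<open>1\<close>.\<close>

lemma Holder_sum:
  fixes f g :: "'a \<Rightarrow> real"
  assumes "0 < \<alpha>" "\<alpha> < 1" and f: "\<And>i. i \<in> A \<Longrightarrow> f i \<ge> 0" and g: "\<And>i. i \<in> A \<Longrightarrow> g i \<ge> 0"
  shows "(\<Sum>i\<in>A. f i powr \<alpha> * g i powr (1 - \<alpha>)) \<le> (\<Sum>i\<in>A. f i) powr \<alpha> * (\<Sum>i\<in>A. g i) powr (1 - \<alpha>)"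
proof (cases "finite A")
  case True
  define F G where "F = (\<Sum>i\<in>A. f i)" and "G = (\<Sum>i\<in>A. g i)"
  have FG: "F \<ge> 0" "G \<ge> 0"
    unfolding F_def G_def using f g by (auto intro: sum_nonneg)
  show ?thesis
  proof (cases "F = 0 \<or> G = 0")
    case zero: True
    then have "f i = 0 \<or> g i = 0" if "i \<in> A" for i
      using that True f g by (auto simp: F_def G_def sum_nonneg_eq_0_iff)
    then have "(\<Sum>i\<in>A. f i powr \<alpha> * g i powr (1 - \<alpha>)) = 0"
      by (intro sum.neutral) auto
    then show ?thesis
      using zero by (simp flip: F_def G_def)
  next
    case False
    then have pos: "F > 0" "G > 0"
      using FG by auto
    have "f i powr \<alpha> * g i powr (1 - \<alpha>) \<le>
        (F powr \<alpha> * G powr (1 - \<alpha>)) * (\<alpha> * (f i / F) + (1 - \<alpha>) * (g i / G))" if "i \<in> A" for i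
    proof -
      have "f i powr \<alpha> * g i powr (1 - \<alpha>) =
          (F powr \<alpha> * G powr (1 - \<alpha>)) * ((f i / F) powr \<alpha> * (g i / G) powr (1 - \<alpha>))"
        using pos f[OF that] g[OF that] by (simp add: powr_divide)
      also have "\<dots> \<le> (F powr \<alpha> * G powr (1 - \<alpha>)) * (\<alpha> * (f i / F) + (1 - \<alpha>) * (g i / G))"
        using pos f[OF that] g[OF that] assms by (intro mult_left_mono Young_powr) auto
      finally show ?thesis .
    qed
    then have "(\<Sum>i\<in>A. f i powr \<alpha> * g i powr (1 - \<alpha>)) \<le>
        (\<Sum>i\<in>A. (F powr \<alpha> * G powr (1 - \<alpha>)) * (\<alpha> * (f i / F) + (1 - \<alpha>) * (g i / G)))"
      by (rule sum_mono)
    also have "\<dots> = (F powr \<alpha> * G powr (1 - \<alpha>)) * (\<alpha> * (F / F) + (1 - \<alpha>) * (G / G))"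
      by (simp add: F_def G_def sum.distrib flip: sum_distrib_left sum_divide_distrib)
    also have "\<dots> = F powr \<alpha> * G powr (1 - \<alpha>)"
      using pos by simp
    finally show ?thesis
      by (simp add: F_def G_def)
  qed
qed auto

lemma mean_Holder:
  assumes "0 < \<alpha>" "\<alpha> < 1" "\<And>x. x \<in> hypercube V \<Longrightarrow> f x \<ge> 0" "\<And>x. x \<in> hypercube V \<Longrightarrow> g x \<ge> 0"
  shows "mean V (\<lambda>x. f x powr \<alpha> * g x powr (1 - \<alpha>)) \<le> mean V f powr \<alpha> * mean V g powr (1 - \<alpha>)"
proof -
  have nn: "(\<Sum>x\<in>hypercube V. f x) \<ge> 0" "(\<Sum>x\<in>hypercube V. g x) \<ge> 0"
    using assms by (auto intro: sum_nonneg)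
  have "(2 ^ card V) powr \<alpha> * (2 ^ card V :: real) powr (1 - \<alpha>) = 2 ^ card V"
    by (simp flip: powr_add)
  then show ?thesis
    using Holder_sum[of \<alpha> "hypercube V" f g] assms nn unfolding mean_def
    by (simp add: powr_divide divide_right_mono)
qed

text \<open>Hoelder interpolates the second moment \<open>X\<close> between the moments of order
  \<open>p\<close> and \<open>4\<close>; \<open>Bonami_4\<close> bounds the fourth by a multiple of
  the square of \<open>X\<close>, and the resulting inequality is solved for
  \<open>X\<close>.\<close>

lemma mean_square_powr_le:
  assumes "finite V" "degree_le d V a" "k \<ge> 1"
  shows "mean V (\<lambda>x. (walsh_sum V a x)\<^sup>2) powr (real k / (real k + 1)) \<le>
    9 powr (real d / (real k + 1)) * mean V (\<lambda>x. \<bar>walsh_sum V a x\<bar> powr (2 * real k / (real k + 1)))"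
proof -
  define g where "g = walsh_sum V a"
  define p where "p = 2 * real k / (real k + 1)"
  \<comment> \<open>The weight determined by \<open>p * s + 4 * (1 - s) = 2\<close>.\<close>
  define s where "s = (real k + 1) / (real k + 2)"
  define X Y Z where "X = mean V (\<lambda>x. (g x)\<^sup>2)" and "Y = mean V (\<lambda>x. \<bar>g x\<bar> powr p)"
    and "Z = mean V (\<lambda>x. g x ^ 4)"
  have s: "0 < s" "s < 1" "1 - s = 1 / (real k + 2)" "p * s + 4 * (1 - s) = 2"
    using assms(3) by (auto simp: s_def p_def divide_simps) (auto simp: algebra_simps)?
  have nn: "X \<ge> 0" "Y \<ge> 0" "Z \<ge> 0"
    unfolding X_def Y_def Z_def by (auto intro!: mean_nonneg)
  have split: "(g x)\<^sup>2 = (\<bar>g x\<bar> powr p) powr s * (g x ^ 4) powr (1 - s)" for x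
  proof (cases "g x = 0")
    case False
    have "(\<bar>g x\<bar> powr p) powr s * (\<bar>g x\<bar> powr 4) powr (1 - s) = \<bar>g x\<bar> powr 2"
      by (simp only: powr_powr s(4) flip: powr_add)
    moreover have "\<bar>g x\<bar> powr 4 = g x ^ 4" "\<bar>g x\<bar> powr 2 = (g x)\<^sup>2"
      using False by (simp_all add: powr_numeral)
    ultimately show ?thesis
      by simp
  qed simp
  have "X \<le> Y powr s * Z powr (1 - s)"
    unfolding X_def Y_def Z_def split using s by (intro mean_Holder) auto
  also have "\<dots> \<le> Y powr s * (9 ^ d * X\<^sup>2) powr (1 - s)"
    using Bonami_4[OF assms(1,2)] s nn unfolding g_def X_def Z_def
    by (intro mult_left_mono powr_mono2) auto
  finally have le: "X \<le> Y powr s * (9 ^ d * X\<^sup>2) powr (1 - s)" .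
  show ?thesis
  proof (cases "X = 0")
    case True
    then show ?thesis
      using nn by (simp add: X_def Y_def g_def p_def)
  next
    case False
    then have X: "X > 0"
      using nn by simp
    have "(9 ^ d * X\<^sup>2) powr (1 - s) = 9 powr (real d / (real k + 2)) * X powr (2 / (real k + 2))"
    proof -
      have "9 ^ d * X\<^sup>2 = 9 powr real d * X powr 2"
        using X by (simp add: powr_realpow powr_numeral)
      then have "(9 ^ d * X\<^sup>2) powr (1 - s) = (9 powr real d) powr (1 - s) * (X powr 2) powr (1 - s)"
        by (simp only: powr_mult powr_ge_zero)
      also have "\<dots> = 9 powr (real d / (real k + 2)) * X powr (2 / (real k + 2))"
        unfolding powr_powr s(3) by simp
      finally show ?thesis .
    qed
    with le have "X powr 1 \<le> (Y powr s * 9 powr (real d / (real k + 2))) * X powr (2 / (real k + 2))"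
      using X by simp
    \<comment> \<open>A power of \<open>X\<close> now stands on both sides. After cancelling it, the
      power \<open>1 / s\<close> turns the exponent \<open>k/(k+2)\<close> into
      \<open>k/(k+1)\<close>.\<close>
    moreover have "X powr 1 = X powr (real k / (real k + 2)) * X powr (2 / (real k + 2))"
      by (simp add: add_divide_distrib[symmetric] flip: powr_add)
    ultimately have "X powr (real k / (real k + 2)) * X powr (2 / (real k + 2)) \<le>
        (Y powr s * 9 powr (real d / (real k + 2))) * X powr (2 / (real k + 2))"
      by (simp only:)
    then have "X powr (real k / (real k + 2)) \<le> Y powr s * 9 powr (real d / (real k + 2))"
      by (rule mult_right_le_imp_le) (use X in simp)
    then have "(X powr (real k / (real k + 2))) powr (1 / s) \<le> (Y powr s * 9 powr (real d / (real k + 2))) powr (1 / s)"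
      using s by (intro powr_mono2) auto
    also have "(X powr (real k / (real k + 2))) powr (1 / s) = X powr (real k / (real k + 1))"
      by (simp add: powr_powr s_def)
    also have "(Y powr s * 9 powr (real d / (real k + 2))) powr (1 / s) = Y * 9 powr (real d / (real k + 1))"
      using s nn by (simp add: powr_mult powr_powr) (simp add: s_def)
    finally show ?thesis
      by (simp add: X_def Y_def g_def p_def mult.commute)
  qed
qed

section \<open>A Blei-type inequality for blocks of unequal sizes\<close>

lemma prod_powr_le_weighted_sum:
  fixes y \<theta> :: "'a \<Rightarrow> real"
  assumes "finite J" "\<And>j. j \<in> J \<Longrightarrow> \<theta> j \<ge> 0" "(\<Sum>j\<in>J. \<theta> j) = 1" "\<And>j. j \<in> J \<Longrightarrow> y j > 0"
  shows "(\<Prod>j\<in>J. y j powr \<theta> j) \<le> (\<Sum>j\<in>J. \<theta> j * y j)"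
proof -
  have "J \<noteq> {}"
    using assms(3) by auto
  then have "(\<Sum>j\<in>J. \<theta> j * ln (y j)) \<le> ln (\<Sum>j\<in>J. \<theta> j *\<^sub>R y j)"
    using assms by (intro concave_on_sum[OF _ _ ln_concave]) auto
  moreover have "(\<Sum>j\<in>J. \<theta> j * y j) > 0"
  proof -
    obtain j where "j \<in> J" "\<theta> j > 0"
      using assms(2,3) by (metis less_eq_real_def sum.neutral zero_neq_one)
    then show ?thesis
      using assms by (intro sum_pos2[of J j]) (auto simp: less_imp_le)
  qed
  ultimately have "exp (\<Sum>j\<in>J. \<theta> j * ln (y j)) \<le> (\<Sum>j\<in>J. \<theta> j * y j)"
    by (simp add: ln_ge_iff)
  also have "exp (\<Sum>j\<in>J. \<theta> j * ln (y j)) = (\<Prod>j\<in>J. y j powr \<theta> j)"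
    unfolding exp_sum[OF assms(1)] using assms(4) by (intro prod.cong) (force simp: powr_def)+
  finally show ?thesis .
qed

text \<open>Expanding the product of sums gives one nonnegative term per choice function on
  \<open>J\<close>; by \<open>inj\<close> the left side is a subfamily of these terms.\<close>

lemma sum_prod_le_prod_sum:
  fixes v :: "'j \<Rightarrow> 'b \<Rightarrow> real" and T :: "'j \<Rightarrow> 'a \<Rightarrow> 'b"
  assumes "finite J" "\<And>j. j \<in> J \<Longrightarrow> finite (B j)"
    and T: "\<And>j S. j \<in> J \<Longrightarrow> S \<in> F \<Longrightarrow> T j S \<in> B j"
    and inj: "\<And>S S'. S \<in> F \<Longrightarrow> S' \<in> F \<Longrightarrow> (\<And>j. j \<in> J \<Longrightarrow> T j S = T j S') \<Longrightarrow> S = S'"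
    and v: "\<And>j t. j \<in> J \<Longrightarrow> t \<in> B j \<Longrightarrow> v j t \<ge> 0"
  shows "(\<Sum>S\<in>F. \<Prod>j\<in>J. v j (T j S)) \<le> (\<Prod>j\<in>J. \<Sum>t\<in>B j. v j t)"
proof -
  define \<phi> where "\<phi> S = (\<lambda>j\<in>J. T j S)" for S
  have inj': "inj_on \<phi> F"
  proof (rule inj_onI)
    fix S S' assume *: "S \<in> F" "S' \<in> F" "\<phi> S = \<phi> S'"
    have "T j S = T j S'" if "j \<in> J" for j
      using fun_cong[OF *(3), of j] that by (simp add: \<phi>_def)
    then show "S = S'"
      using inj * by blast
  qed
  have "(\<Sum>S\<in>F. \<Prod>j\<in>J. v j (T j S)) = (\<Sum>S\<in>F. \<Prod>j\<in>J. v j (\<phi> S j))"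
    by (simp add: \<phi>_def)
  also have "\<dots> = (\<Sum>h\<in>\<phi> ` F. \<Prod>j\<in>J. v j (h j))"
    using inj' by (simp add: sum.reindex)
  also have "\<dots> \<le> (\<Sum>h\<in>PiE J B. \<Prod>j\<in>J. v j (h j))"
    using assms by (intro sum_mono2) (auto simp: \<phi>_def intro!: finite_PiE prod_nonneg v)
  also have "\<dots> = (\<Prod>j\<in>J. \<Sum>t\<in>B j. v j t)"
    using assms by (simp add: prod_sum_PiE)
  finally show ?thesis .
qed

text \<open>
  Hoelder with exponents \<open>(d+1)/d\<close> and \<open>d+1\<close>, applied to \<open>q / R\<close> and \<open>R powr d\<close>. The exponents
  in \<open>R\<close> are chosen such that both sums reduce to sums of \<open>u t powr (\<kappa> j / (\<kappa> j + 1))\<close>: the first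
  one by the weighted arithmetic-geometric mean inequality, the second one since the blocks
  determine \<open>S\<close>.
\<close>
lemma Blei_partition:
  fixes q :: "'a \<Rightarrow> real" and T :: "nat \<Rightarrow> 'a \<Rightarrow> 'b" and u :: "'b \<Rightarrow> real" and \<kappa> :: "nat \<Rightarrow> nat"
  assumes fin: "finite F" "\<And>j. j < m \<Longrightarrow> finite (B j)"
    and q: "\<And>S. S \<in> F \<Longrightarrow> q S \<ge> 0"
    and \<kappa>: "\<And>j. j < m \<Longrightarrow> \<kappa> j \<ge> 1" "(\<Sum>j<m. \<kappa> j) = d" "d \<ge> 1"
    and T: "\<And>j S. j < m \<Longrightarrow> S \<in> F \<Longrightarrow> T j S \<in> B j"
    and inj: "\<And>S S'. S \<in> F \<Longrightarrow> S' \<in> F \<Longrightarrow> (\<And>j. j < m \<Longrightarrow> T j S = T j S') \<Longrightarrow> S = S'"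
    and u: "\<And>j t. j < m \<Longrightarrow> t \<in> B j \<Longrightarrow> (\<Sum>S\<in>{S\<in>F. T j S = t}. q S) \<le> u t"
    and W: "\<And>j. j < m \<Longrightarrow> (\<Sum>t\<in>B j. u t powr (real (\<kappa> j) / (real (\<kappa> j) + 1))) \<le> W" "W \<ge> 1"
  shows "(\<Sum>S\<in>F. q S powr (real d / (real d + 1))) \<le> W powr (2 * real d / (real d + 1))"
proof -
  \<comment> \<open>Terms with \<open>q S = 0\<close> contribute nothing; on the others every
    \<open>u (T j S)\<close> is positive, so negative powers and division by \<open>R S\<close> make
    sense.\<close>
  define P where "P = {S \<in> F. q S > 0}"
  define \<alpha> where "\<alpha> = real d / (real d + 1)"
  define \<theta> where "\<theta> j = real (\<kappa> j) / real d" for j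
  define R where "R S = (\<Prod>j<m. (u (T j S) powr (1 / (real (\<kappa> j) + 1))) powr \<theta> j)" for S
  have finP: "finite P" and PF: "P \<subseteq> F"
    using fin by (auto simp: P_def)
  have \<alpha>: "0 < \<alpha>" "\<alpha> < 1" "1 - \<alpha> = 1 / (real d + 1)"
    using \<kappa>(3) by (auto simp: \<alpha>_def field_simps)
  have \<theta>: "\<theta> j \<ge> 0" for j
    by (simp add: \<theta>_def)
  have sum\<theta>: "(\<Sum>j<m. \<theta> j) = 1"
    using \<kappa>(2,3) by (simp add: \<theta>_def flip: sum_divide_distrib of_nat_sum)
  have u_pos: "u (T j S) > 0" if "j < m" "S \<in> P" for j S
  proof -
    have "q S \<le> (\<Sum>S'\<in>{S'\<in>F. T j S' = T j S}. q S')"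
      using that fin q by (intro member_le_sum) (auto simp: P_def)
    also have "\<dots> \<le> u (T j S)"
      using that T by (intro u) (auto simp: P_def)
    finally show ?thesis
      using that by (auto simp: P_def)
  qed
  have u_nonneg: "u t \<ge> 0" if "j < m" "t \<in> B j" for j t
    using q by (intro order_trans[OF sum_nonneg u[OF that]]) auto
  have R_pos: "R S > 0" if "S \<in> P" for S
    unfolding R_def
  proof (rule prod_pos)
    fix j assume "j \<in> {..<m}"
    then have "u (T j S) > 0"
      using that by (intro u_pos) auto
    then show "(u (T j S) powr (1 / (real (\<kappa> j) + 1))) powr \<theta> j > 0"
      by simp
  qed
  have R_powr: "R S powr real d = (\<Prod>j<m. u (T j S) powr (real (\<kappa> j) / (real (\<kappa> j) + 1)))" for S
  proof -
    have "R S powr real d = (\<Prod>j<m. ((u (T j S) powr (1 / (real (\<kappa> j) + 1))) powr \<theta> j) powr real d)"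
      unfolding R_def by (rule prod_powr_distrib)
    also have "\<dots> = (\<Prod>j<m. u (T j S) powr (real (\<kappa> j) / (real (\<kappa> j) + 1)))"
      using \<kappa>(3) by (simp add: powr_powr \<theta>_def)
    finally show ?thesis .
  qed
  \<comment> \<open>There are at most \<open>d\<close> blocks because each has size at least
    \<open>1\<close>; together with \<open>W \<ge> 1\<close> this replaces \<open>W ^ m\<close> by
    \<open>W powr real d\<close>.\<close>
  have "m \<le> d"
    using sum_mono[of "{..<m}" "\<lambda>_. 1" \<kappa>] \<kappa>(1,2) by simp
  have "(\<Sum>S\<in>P. R S powr real d) \<le> (\<Prod>j<m. \<Sum>t\<in>B j. u t powr (real (\<kappa> j) / (real (\<kappa> j) + 1)))"
    unfolding R_powr
  proof (rule sum_prod_le_prod_sum[where T = T and v = "\<lambda>j t. u t powr (real (\<kappa> j) / (real (\<kappa> j) + 1))"])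
    show "S = S'" if "S \<in> P" "S' \<in> P" "\<And>j. j \<in> {..<m} \<Longrightarrow> T j S = T j S'" for S S'
      using that PF by (intro inj) auto
  qed (use fin T PF in auto)
  also have "\<dots> \<le> (\<Prod>j<m. W)"
    using W by (intro prod_mono) (auto intro: sum_nonneg)
  also have "\<dots> \<le> W powr real d"
    using \<open>m \<le> d\<close> W(2) by (simp add: powr_realpow power_increasing)
  finally have sumR: "(\<Sum>S\<in>P. R S powr real d) \<le> W powr real d" .
  \<comment> \<open>Grouping by the \<open>j\<close>-th block \<open>t\<close> turns the sum of
    \<open>q\<close> into at most \<open>u t\<close>, and \<open>1 - 1/(\<kappa> j + 1)\<close> is
    the exponent in the hypothesis on \<open>W\<close>.\<close>
  have block: "(\<Sum>S\<in>P. q S * u (T j S) powr (- 1 / (real (\<kappa> j) + 1))) \<le> W" if j: "j < m" for j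
  proof -
    have "(\<Sum>S\<in>P. q S * u (T j S) powr (- 1 / (real (\<kappa> j) + 1))) \<le>
        (\<Sum>S\<in>F. q S * u (T j S) powr (- 1 / (real (\<kappa> j) + 1)))"
      using fin q PF by (intro sum_mono2) auto
    also have "\<dots> = (\<Sum>t\<in>B j. \<Sum>S\<in>{S\<in>F. T j S = t}. q S * u (T j S) powr (- 1 / (real (\<kappa> j) + 1)))"
      using fin T j by (intro sum.group[symmetric]) auto
    also have "\<dots> = (\<Sum>t\<in>B j. (\<Sum>S\<in>{S\<in>F. T j S = t}. q S) * u t powr (- 1 / (real (\<kappa> j) + 1)))"
      by (intro sum.cong) (auto simp: sum_distrib_right)
    also have "\<dots> \<le> (\<Sum>t\<in>B j. u t * u t powr (- 1 / (real (\<kappa> j) + 1)))"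
      using j by (intro sum_mono mult_right_mono u) auto
    also have "\<dots> = (\<Sum>t\<in>B j. u t powr (real (\<kappa> j) / (real (\<kappa> j) + 1)))"
    proof (intro sum.cong refl)
      fix t assume t: "t \<in> B j"
      have "1 + - 1 / (real (\<kappa> j) + 1) = real (\<kappa> j) / (real (\<kappa> j) + 1)"
        by (simp add: field_simps)
      then show "u t * u t powr (- 1 / (real (\<kappa> j) + 1)) = u t powr (real (\<kappa> j) / (real (\<kappa> j) + 1))"
        using u_nonneg[OF j t] by (metis powr_add powr_one)
    qed
    also have "\<dots> \<le> W"
      using j by (rule W)
    finally show ?thesis .
  qed
  have "q S / R S \<le> (\<Sum>j<m. \<theta> j * (q S * u (T j S) powr (- 1 / (real (\<kappa> j) + 1))))" if S: "S \<in> P" for S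
  proof -
    \<comment> \<open>\<open>1 / R S\<close> is a geometric mean with weights
      \<open>\<theta>\<close>, so it is at most the corresponding arithmetic mean.\<close>
    have "1 / R S = (\<Prod>j<m. (u (T j S) powr (- 1 / (real (\<kappa> j) + 1))) powr \<theta> j)"
    proof -
      have "(u (T j S) powr (- 1 / (real (\<kappa> j) + 1))) powr \<theta> j = inverse ((u (T j S) powr (1 / (real (\<kappa> j) + 1))) powr \<theta> j)" for j
        by (simp add: powr_powr flip: powr_minus)
      then show ?thesis
        unfolding R_def by (simp only: inverse_eq_divide[symmetric] prod_inversef[symmetric] comp_def)
    qed
    also have "\<dots> \<le> (\<Sum>j<m. \<theta> j * u (T j S) powr (- 1 / (real (\<kappa> j) + 1)))"
    proof (rule prod_powr_le_weighted_sum)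
      fix j assume "j \<in> {..<m}"
      then have "u (T j S) > 0"
        using S by (intro u_pos) auto
      then show "u (T j S) powr (- 1 / (real (\<kappa> j) + 1)) > 0"
        by simp
    qed (use \<theta> sum\<theta> in auto)
    finally have "q S * (1 / R S) \<le> q S * \<dots>"
      using S by (intro mult_left_mono) (auto simp: P_def)
    then show ?thesis
      by (simp add: sum_distrib_left algebra_simps)
  qed
  then have "(\<Sum>S\<in>P. q S / R S) \<le> (\<Sum>S\<in>P. \<Sum>j<m. \<theta> j * (q S * u (T j S) powr (- 1 / (real (\<kappa> j) + 1))))"
    by (rule sum_mono)
  also have "\<dots> = (\<Sum>j<m. \<theta> j * (\<Sum>S\<in>P. q S * u (T j S) powr (- 1 / (real (\<kappa> j) + 1))))"
    by (subst sum.swap) (simp add: sum_distrib_left)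
  also have "\<dots> \<le> (\<Sum>j<m. \<theta> j * W)"
    using block \<theta> by (intro sum_mono mult_left_mono) auto
  also have "\<dots> = W"
    by (simp add: sum\<theta> flip: sum_distrib_right)
  finally have sumq: "(\<Sum>S\<in>P. q S / R S) \<le> W" .
  have "(\<Sum>S\<in>F. q S powr \<alpha>) = (\<Sum>S\<in>P. q S powr \<alpha>)"
    using fin q by (intro sum.mono_neutral_right) (auto simp: P_def order.order_iff_strict)
  also have "\<dots> = (\<Sum>S\<in>P. (q S / R S) powr \<alpha> * (R S powr real d) powr (1 - \<alpha>))"
  proof (intro sum.cong refl)
    fix S assume S: "S \<in> P"
    have "(R S powr real d) powr (1 - \<alpha>) = R S powr \<alpha>"
      by (simp add: powr_powr \<alpha>) (simp add: \<alpha>_def)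
    then show "q S powr \<alpha> = (q S / R S) powr \<alpha> * (R S powr real d) powr (1 - \<alpha>)"
      using R_pos[OF S] S by (simp add: powr_divide P_def)
  qed
  also have "\<dots> \<le> (\<Sum>S\<in>P. q S / R S) powr \<alpha> * (\<Sum>S\<in>P. R S powr real d) powr (1 - \<alpha>)"
    using R_pos \<alpha> by (intro Holder_sum) (auto simp: P_def less_imp_le)
  also have "\<dots> \<le> W powr \<alpha> * (W powr real d) powr (1 - \<alpha>)"
    using sumq sumR \<alpha> R_pos by (intro mult_mono powr_mono2) (auto intro!: sum_nonneg simp: P_def less_imp_le)
  \<comment> \<open>Since \<open>d * (1 - \<alpha>) = \<alpha>\<close>, each of the two factors is
    \<open>W powr \<alpha>\<close>.\<close>
  also have "\<dots> = W powr (2 * real d / (real d + 1))"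
    by (simp add: powr_powr \<alpha> flip: powr_add) (simp add: \<alpha>_def flip: add_divide_distrib)
  finally show ?thesis
    by (simp add: \<alpha>_def)
qed

section \<open>Taylor expansion and the reduction to blocks\<close>

text \<open>Coefficients of the partial derivative of the multilinear extension in all variables of
  \<open>T\<close>; it is free of these variables, hence the \<open>0\<close>.\<close>

definition wderiv :: "(nat set \<Rightarrow> real) \<Rightarrow> nat set \<Rightarrow> nat set \<Rightarrow> real" where
  "wderiv a T R = (if R \<inter> T = {} then a (R \<union> T) else 0)"

text \<open>Reindexing by \<open>S = R \<union> T\<close>; the \<open>R\<close> meeting
  \<open>T\<close> drop out by the assumption on \<open>g\<close>. Squares \<open>g\<close> serve
  Parseval, monomials \<open>g\<close> serve evaluation.\<close>

lemma sum_wderiv: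
  fixes g :: "real \<Rightarrow> nat set \<Rightarrow> real"
  assumes "finite V" "T \<subseteq> V" and g: "\<And>R. g 0 R = 0"
  shows "(\<Sum>R\<in>Pow V. g (wderiv a T R) R) = (\<Sum>S\<in>{S\<in>Pow V. T \<subseteq> S}. g (a S) (S - T))"
proof -
  have "(\<Sum>R\<in>Pow V. g (wderiv a T R) R) = (\<Sum>R\<in>{R\<in>Pow V. R \<inter> T = {}}. g (a (R \<union> T)) R)"
    using assms by (intro sum.mono_neutral_cong_right) (auto simp: wderiv_def)
  also have "\<dots> = (\<Sum>S\<in>{S\<in>Pow V. T \<subseteq> S}. g (a S) (S - T))"
    using assms(2)
    by (intro sum.reindex_bij_witness[of _ "\<lambda>S. S - T" "\<lambda>R. R \<union> T"]) (auto intro!: arg_cong2[where f = g] arg_cong[where f = a])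
  finally show ?thesis .
qed

lemma wderiv_eq_0:
  assumes "finite V" "degree_le d V a" "T \<subseteq> V" "R \<subseteq> V" "card R > d \<or> card T > d"
  shows "wderiv a T R = 0"
proof -
  have "finite (R \<union> T)"
    using assms finite_subset by blast
  then have "card R \<le> card (R \<union> T)" "card T \<le> card (R \<union> T)"
    by (auto intro: card_mono)
  then have "a (R \<union> T) = 0"
    using assms unfolding degree_le_def by (metis Un_least leD linorder_not_le order_less_le_trans)
  then show ?thesis
    by (simp add: wderiv_def)
qed

text \<open>Expanding the product of the \<open>t * y i + u i\<close> over \<open>S\<close> selects
  the set \<open>T\<close> of indices contributing \<open>t * y i\<close>. Multilinearity leaves no
  factorials.\<close>

lemma walsh_sum_Taylor:
  assumes "finite V"
  shows "walsh_sum V a (\<lambda>i. u i + t * y i) =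
    (\<Sum>T\<in>Pow V. t ^ card T * (walsh T y * walsh_sum V (wderiv a T) u))"
proof -
  have walsh: "walsh S (\<lambda>i. u i + t * y i) = (\<Sum>T\<in>{T\<in>Pow V. T \<subseteq> S}. t ^ card T * walsh T y * walsh (S - T) u)"
    if "S \<subseteq> V" for S
  proof -
    have "finite S"
      using that assms finite_subset by auto
    have "walsh S (\<lambda>i. u i + t * y i) = (\<Prod>i\<in>S. t * y i + u i)"
      by (simp add: walsh_def add.commute)
    also have "\<dots> = (\<Sum>T\<in>Pow S. (\<Prod>i\<in>T. t * y i) * (\<Prod>i\<in>S - T. u i))"
      using \<open>finite S\<close> by (rule prod_add)
    also have "Pow S = {T\<in>Pow V. T \<subseteq> S}"
      using that by auto
    finally show ?thesis
      by (simp add: prod.distrib walsh_def)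
  qed
  have "walsh_sum V a (\<lambda>i. u i + t * y i) =
      (\<Sum>S\<in>Pow V. \<Sum>T\<in>{T\<in>Pow V. T \<subseteq> S}. a S * (t ^ card T * walsh T y * walsh (S - T) u))"
    unfolding walsh_sum_def by (intro sum.cong) (auto simp: walsh sum_distrib_left)
  also have "\<dots> = (\<Sum>T\<in>Pow V. \<Sum>S\<in>{S\<in>Pow V. T \<subseteq> S}. a S * (t ^ card T * walsh T y * walsh (S - T) u))"
    using assms by (intro sum.swap_restrict) auto
  also have "\<dots> = (\<Sum>T\<in>Pow V. t ^ card T * (walsh T y * walsh_sum V (wderiv a T) u))"
  proof (intro sum.cong refl)
    fix T assume "T \<in> Pow V"
    then show "(\<Sum>S\<in>{S\<in>Pow V. T \<subseteq> S}. a S * (t ^ card T * walsh T y * walsh (S - T) u)) =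
        t ^ card T * (walsh T y * walsh_sum V (wderiv a T) u)"
      using sum_wderiv[of V T "\<lambda>c R. c * walsh R u" a] assms
      by (simp add: walsh_sum_def sum_distrib_left algebra_simps)
  qed
  finally show ?thesis .
qed

lemma walsh_sum_scale: "walsh_sum V a (\<lambda>i. \<rho> * x i) = walsh_sum V (\<lambda>S. \<rho> ^ card S * a S) x"
  by (simp add: walsh_sum_def walsh_def prod.distrib algebra_simps)

lemma hypercube_upd:
  "x \<in> hypercube V \<Longrightarrow> e \<in> {- 1, 1} \<Longrightarrow> x(i := e) \<in> hypercube (insert i V)"
  unfolding hypercube_def by (intro PiE_fun_upd)

text \<open>An affine function on \<open>[-1, 1]\<close> is bounded by its values at the endpoints;
  this is applied to one coordinate after the other.\<close>

lemma walsh_sum_le_on_solid_cube: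
  assumes "finite V" "\<And>x. x \<in> hypercube V \<Longrightarrow> \<bar>walsh_sum V a x\<bar> \<le> M" "\<And>i. i \<in> V \<Longrightarrow> \<bar>z i\<bar> \<le> 1"
  shows "\<bar>walsh_sum V a z\<bar> \<le> M"
  using assms
proof (induction V arbitrary: a rule: finite_induct)
  case empty
  then show ?case by (simp add: hypercube_def walsh_sum_def walsh_def)
next
  case (insert i V)
  define b where "b = (\<lambda>S. a (insert i S))"
  have comb: "walsh_sum V (\<lambda>S. a S + e * b S) x = walsh_sum V a x + e * walsh_sum V b x" for e x
    by (simp add: walsh_sum_def algebra_simps sum.distrib sum_distrib_left)
  have "walsh_sum (insert i V) a (z(i := z i)) = walsh_sum V (\<lambda>S. a S + z i * b S) z"
    unfolding comb unfolding b_def using insert(1,2) by (rule walsh_sum_insert)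
  moreover have "\<bar>walsh_sum V (\<lambda>S. a S + z i * b S) z\<bar> \<le> M"
  proof (rule insert.IH)
    fix x assume x: "x \<in> hypercube V"
    have ends: "\<bar>walsh_sum V a x + e * walsh_sum V b x\<bar> \<le> M" if "e \<in> {- 1, 1}" for e
      using insert.prems(1)[OF hypercube_upd[OF x that, of i]]
      unfolding walsh_sum_insert[OF insert(1,2)] b_def .
    have "\<bar>z i * walsh_sum V b x\<bar> \<le> \<bar>walsh_sum V b x\<bar>"
      using insert.prems(2)[of i] by (simp add: abs_mult mult_left_le_one_le)
    then show "\<bar>walsh_sum V (\<lambda>S. a S + z i * b S) x\<bar> \<le> M"
      using ends[of 1] ends[of "- 1"] unfolding comb by (simp split: abs_split)
  qed (use insert.prems in auto)
  ultimately show ?case by simp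
qed

lemma abs_hypercube: "x \<in> hypercube V \<Longrightarrow> i \<in> V \<Longrightarrow> \<bar>x i\<bar> = 1"
  by (fastforce simp: hypercube_def PiE_iff)

text \<open>The sum is, up to the factor \<open>(1 - \<rho>) ^ j\<close>, the coefficient of
  \<open>t ^ j\<close> in the restriction of the function to a segment inside the solid cube. That
  factor causes the \<open>real d + 1\<close>.\<close>

lemma homogeneous_Taylor_bound:
  assumes V: "finite V" "degree_le d V a" and d: "d \<ge> 1" "j \<le> d"
    and bound: "\<And>x. x \<in> hypercube V \<Longrightarrow> \<bar>walsh_sum V a x\<bar> \<le> 1"
    and xy: "x \<in> hypercube V" "y \<in> hypercube V"
  defines "\<rho> \<equiv> real d / (real d + 1)"
  shows "\<bar>\<Sum>T\<in>{T\<in>Pow V. card T = j}. walsh T y * walsh_sum V (wderiv a T) (\<lambda>i. \<rho> * x i)\<bar>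
    \<le> 3 * (2 * real d * (real d + 1)) ^ j"
proof -
  define E where "E T = walsh T y * walsh_sum V (wderiv a T) (\<lambda>i. \<rho> * x i)" for T
  define h where "h l = (\<Sum>T\<in>{T\<in>Pow V. card T = l}. E T)" for l
  have \<rho>: "0 \<le> \<rho>" "1 - \<rho> = 1 / (real d + 1)"
    by (auto simp: \<rho>_def field_simps)
  have E0: "E T = 0" if "T \<subseteq> V" "card T > d" for T
    using that V by (auto simp: E_def walsh_sum_def wderiv_eq_0 intro!: sum.neutral)
  have "\<bar>\<Sum>l\<le>d. ((1 - \<rho>) ^ l * h l) * t ^ l\<bar> \<le> 1" if t: "\<bar>t\<bar> \<le> 1" for t
  proof -
    have "(\<Sum>l\<le>d. ((1 - \<rho>) ^ l * h l) * t ^ l) = (\<Sum>l\<le>d. \<Sum>T\<in>{T\<in>{T\<in>Pow V. card T \<le> d}. card T = l}. (t * (1 - \<rho>)) ^ card T * E T)"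
      by (auto simp: h_def sum_distrib_left sum_distrib_right power_mult_distrib mult_ac intro!: sum.cong)
    also have "\<dots> = (\<Sum>T\<in>{T\<in>Pow V. card T \<le> d}. (t * (1 - \<rho>)) ^ card T * E T)"
      using V by (intro sum.group) auto
    also have "\<dots> = (\<Sum>T\<in>Pow V. (t * (1 - \<rho>)) ^ card T * E T)"
      using V E0 by (intro sum.mono_neutral_left) auto
    also have "\<dots> = walsh_sum V a (\<lambda>i. \<rho> * x i + t * (1 - \<rho>) * y i)"
      unfolding E_def using V by (subst walsh_sum_Taylor) auto
    finally have eq: "(\<Sum>l\<le>d. ((1 - \<rho>) ^ l * h l) * t ^ l) = walsh_sum V a (\<lambda>i. \<rho> * x i + t * (1 - \<rho>) * y i)" .
    show ?thesis
      unfolding eq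
    proof (rule walsh_sum_le_on_solid_cube[OF V(1) bound])
      fix i assume i: "i \<in> V"
      have "\<bar>\<rho> * x i + t * (1 - \<rho>) * y i\<bar> \<le> \<bar>\<rho> * x i\<bar> + \<bar>t * (1 - \<rho>) * y i\<bar>"
        by (rule abs_triangle_ineq)
      also have "\<dots> = \<rho> + \<bar>t\<bar> * (1 - \<rho>)"
        using \<rho> abs_hypercube[OF xy(1) i] abs_hypercube[OF xy(2) i] by (simp add: abs_mult)
      also have "\<dots> \<le> \<rho> + 1 * (1 - \<rho>)"
        using t \<rho> by (intro add_left_mono mult_right_mono) auto
      finally show "\<bar>\<rho> * x i + t * (1 - \<rho>) * y i\<bar> \<le> 1"
        by simp
    qed
  qed
  then have "\<bar>(1 - \<rho>) ^ j * h j\<bar> \<le> 3 * 1 * (2 * real d) ^ j"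
    using d by (intro coeff_le_of_bound_on_interval[where d = d and c = "\<lambda>l. (1 - \<rho>) ^ l * h l"]) auto
  then have "\<bar>h j\<bar> \<le> 3 * (2 * real d) ^ j * (real d + 1) ^ j"
    unfolding \<rho> by (simp add: abs_mult power_divide field_simps)
  then show ?thesis
    by (simp add: h_def E_def power_mult_distrib mult.assoc)
qed

text \<open>The \<open>4\<close> in place of the \<open>2\<close> for a single homogeneous part
  absorbs the number \<open>k + 1\<close> of parts, at most \<open>2 ^ k\<close>.\<close>

definition Taylor_const :: "nat \<Rightarrow> nat \<Rightarrow> real" where
  "Taylor_const d k = 3 * (4 * real d * (real d + 1)) ^ k"

lemma Taylor_bound:
  assumes V: "finite V" "degree_le d V a" and d: "d \<ge> 1" "k \<le> d"
    and bound: "\<And>x. x \<in> hypercube V \<Longrightarrow> \<bar>walsh_sum V a x\<bar> \<le> 1"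
    and xy: "x \<in> hypercube V" "y \<in> hypercube V"
  defines "\<rho> \<equiv> real d / (real d + 1)"
  shows "\<bar>\<Sum>T\<in>{T\<in>Pow V. card T \<le> k}. walsh T y * walsh_sum V (wderiv a T) (\<lambda>i. \<rho> * x i)\<bar> \<le> Taylor_const d k"
proof -
  define E where "E T = walsh T y * walsh_sum V (wderiv a T) (\<lambda>i. \<rho> * x i)" for T
  define L where "L = 2 * real d * (real d + 1)"
  have L: "L \<ge> 1"
    unfolding L_def using d mult_mono[of 1 "2 * real d" 1 "real d + 1"] by simp
  have "(\<Sum>T\<in>{T\<in>Pow V. card T \<le> k}. E T) = (\<Sum>j\<le>k. \<Sum>T\<in>{T\<in>{T\<in>Pow V. card T \<le> k}. card T = j}. E T)"
    using V by (intro sum.group[symmetric]) auto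
  also have "\<dots> = (\<Sum>j\<le>k. \<Sum>T\<in>{T\<in>Pow V. card T = j}. E T)"
    by (intro sum.cong) auto
  finally have "\<bar>\<Sum>T\<in>{T\<in>Pow V. card T \<le> k}. E T\<bar> \<le> (\<Sum>j\<le>k. \<bar>\<Sum>T\<in>{T\<in>Pow V. card T = j}. E T\<bar>)"
    by (simp add: sum_abs)
  also have "\<dots> \<le> (\<Sum>j\<le>k. 3 * L ^ k)"
  proof (intro sum_mono)
    fix j assume j: "j \<in> {..k}"
    have "\<bar>\<Sum>T\<in>{T\<in>Pow V. card T = j}. E T\<bar> \<le> 3 * L ^ j"
      unfolding E_def \<rho>_def L_def using assms j by (intro homogeneous_Taylor_bound) auto
    also have "\<dots> \<le> 3 * L ^ k"
      using L j by (simp add: power_increasing)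
    finally show "\<bar>\<Sum>T\<in>{T\<in>Pow V. card T = j}. E T\<bar> \<le> 3 * L ^ k" .
  qed
  also have "\<dots> = real (Suc k) * (3 * L ^ k)"
    by simp
  also have "\<dots> \<le> 2 ^ k * (3 * L ^ k)"
  proof (rule mult_right_mono)
    have "Suc k \<le> 2 ^ k"
      by (simp add: Suc_leI)
    then show "real (Suc k) \<le> 2 ^ k"
      by (metis of_nat_le_iff of_nat_numeral of_nat_power)
  qed (use L in auto)
  also have "\<dots> = Taylor_const d k"
  proof -
    have "4 * real d * (real d + 1) = 2 * L"
      by (simp add: L_def)
    then show ?thesis
      by (simp only: Taylor_const_def power_mult_distrib mult.left_commute)
  qed
  finally show ?thesis
    by (simp add: E_def)
qed

section \<open>From the inequality for the block sizes to the inequality for degree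
  \<open>d\<close>\<close>

lemma Taylor_const_pos: "d \<ge> 1 \<Longrightarrow> Taylor_const d k > 0"
  by (simp add: Taylor_const_def)

text \<open>The Bohnenblust-Hille inequality with constant \<open>B\<close>, normalised to sup norm
  at most \<open>1\<close> and with the outer root removed.\<close>

definition coeff_bound :: "nat \<Rightarrow> real \<Rightarrow> bool" where
  "coeff_bound k B \<longleftrightarrow> (\<forall>V a. finite V \<longrightarrow> degree_le k V a \<longrightarrow>
     (\<forall>x\<in>hypercube V. \<bar>walsh_sum V a x\<bar> \<le> 1) \<longrightarrow>
     (\<Sum>S\<in>Pow V. \<bar>a S\<bar> powr (2 * real k / (real k + 1))) \<le> B powr (2 * real k / (real k + 1)))"

text \<open>For fixed \<open>T\<close>, Parseval and moment comparison pass to the mean of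
  \<open>\<bar>D T x\<bar> powr p\<close>; for fixed \<open>x\<close>, the degree \<open>k\<close>
  inequality bounds the sum over \<open>T\<close>.\<close>

lemma block_sum_le:
  assumes coeff_bound: "coeff_bound k B" "B \<ge> 0" and k: "1 \<le> k" "k \<le> d" and V: "finite V" "degree_le d V a"
    and bound: "\<And>x. x \<in> hypercube V \<Longrightarrow> \<bar>walsh_sum V a x\<bar> \<le> 1"
  shows "(\<Sum>T\<in>{T\<in>Pow V. card T \<le> k}. (\<Sum>S\<in>{S\<in>Pow V. T \<subseteq> S}. (a S)\<^sup>2) powr (real k / (real k + 1)))
    \<le> 9 powr (1 + real d / (real k + 1)) * (B * Taylor_const d k) powr (2 * real k / (real k + 1))"
proof -
  define p where "p = 2 * real k / (real k + 1)"
  define \<rho> where "\<rho> = real d / (real d + 1)"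
  define A where "A = Taylor_const d k"
  \<comment> \<open>Evaluating at \<open>\<rho> * x\<close> multiplies the coefficient at
    \<open>R\<close> by \<open>\<rho> ^ card R\<close>.\<close>
  define c where "c T R = \<rho> ^ card R * wderiv a T R" for T R
  define D where "D T = walsh_sum V (c T)" for T
  define TT where "TT = {T\<in>Pow V. card T \<le> k}"
  have A: "A > 0"
    unfolding A_def using k by (intro Taylor_const_pos) auto
  have D: "D T x = walsh_sum V (wderiv a T) (\<lambda>i. \<rho> * x i)" for T x
    unfolding D_def c_def by (simp add: walsh_sum_scale)
  have p: "p \<ge> 0"
    by (simp add: p_def)
  have \<rho>: "0 < \<rho>" "\<rho> \<le> 1"
    using k by (auto simp: \<rho>_def)
  \<comment> \<open>Contracting by \<open>\<rho>\<close> shrinks coefficients of degree at most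
    \<open>d\<close> by a factor at most \<open>3\<close>, hence their squares by at most
    \<open>9\<close>.\<close>
  have \<rho>d: "1 \<le> 3 * \<rho> ^ d"
  proof -
    have "1 / \<rho> = 1 + 1 / real d"
      using k by (simp add: \<rho>_def field_simps)
    then have "(1 / \<rho>) ^ d \<le> 3"
      using one_plus_inverse_power_le by metis
    then show ?thesis
      using \<rho> by (simp add: field_simps)
  qed
  have single: "(\<Sum>S\<in>{S\<in>Pow V. T \<subseteq> S}. (a S)\<^sup>2) powr (real k / (real k + 1)) \<le>
      9 powr (1 + real d / (real k + 1)) * mean V (\<lambda>x. \<bar>D T x\<bar> powr p)" if T: "T \<in> TT" for T
  proof -
    have TV: "T \<subseteq> V"
      using T by (auto simp: TT_def)
    have coeff_le: "(wderiv a T R)\<^sup>2 \<le> 9 * (c T R)\<^sup>2" if R: "R \<subseteq> V" for R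
    proof (cases "card R > d")
      case True
      then show ?thesis
        using wderiv_eq_0[OF V TV R] by simp
    next
      case False
      then have "\<rho> ^ d \<le> \<rho> ^ card R"
        using \<rho> by (intro power_decreasing) auto
      then have "1 \<le> 3 * \<rho> ^ card R"
        using \<rho>d by linarith
      then have "1\<^sup>2 \<le> (3 * \<rho> ^ card R)\<^sup>2"
        by (intro power_mono) auto
      then have "1\<^sup>2 * (wderiv a T R)\<^sup>2 \<le> (3 * \<rho> ^ card R)\<^sup>2 * (wderiv a T R)\<^sup>2"
        by (intro mult_right_mono) auto
      then show ?thesis
        by (simp add: c_def power_mult_distrib)
    qed
    have "(\<Sum>S\<in>{S\<in>Pow V. T \<subseteq> S}. (a S)\<^sup>2) = (\<Sum>R\<in>Pow V. (wderiv a T R)\<^sup>2)"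
      using sum_wderiv[OF V(1) TV, of "\<lambda>c R. c\<^sup>2" a] by simp
    also have "\<dots> \<le> (\<Sum>R\<in>Pow V. 9 * (c T R)\<^sup>2)"
      using coeff_le by (intro sum_mono) auto
    also have "\<dots> = 9 * mean V (\<lambda>x. (D T x)\<^sup>2)"
      unfolding D_def by (simp add: mean_walsh_sum_square V flip: sum_distrib_left)
    finally have "(\<Sum>S\<in>{S\<in>Pow V. T \<subseteq> S}. (a S)\<^sup>2) powr (real k / (real k + 1)) \<le>
        (9 * mean V (\<lambda>x. (D T x)\<^sup>2)) powr (real k / (real k + 1))"
      by (intro powr_mono2) (auto intro: sum_nonneg)
    also have "\<dots> = 9 powr (real k / (real k + 1)) * mean V (\<lambda>x. (D T x)\<^sup>2) powr (real k / (real k + 1))"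
      by (rule powr_mult)
    also have "\<dots> \<le> 9 powr 1 * (9 powr (real d / (real k + 1)) * mean V (\<lambda>x. \<bar>D T x\<bar> powr p))"
    proof (intro mult_mono powr_mono)
      have "degree_le d V (c T)"
        using V TV by (auto simp: degree_le_def c_def intro!: wderiv_eq_0)
      then show "mean V (\<lambda>x. (D T x)\<^sup>2) powr (real k / (real k + 1)) \<le>
          9 powr (real d / (real k + 1)) * mean V (\<lambda>x. \<bar>D T x\<bar> powr p)"
        unfolding D_def p_def using V k by (intro mean_square_powr_le) auto
    qed auto
    finally show ?thesis
      by (simp add: powr_add)
  qed
  have point: "(\<Sum>T\<in>TT. \<bar>D T x\<bar> powr p) \<le> (B * A) powr p" if x: "x \<in> hypercube V" for x
  proof -
    \<comment> \<open>The coefficients in \<open>y\<close> of the Taylor part at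
      \<open>\<rho> * x\<close>, divided by its bound \<open>A\<close> so that
      \<open>coeff_bound\<close> applies.\<close>
    define b where "b T = (if card T \<le> k then D T x / A else 0)" for T
    have "(\<Sum>T\<in>Pow V. \<bar>b T\<bar> powr p) \<le> B powr p"
      using coeff_bound(1) unfolding coeff_bound_def p_def
    proof (elim allE impE)
      show "degree_le k V b"
        by (simp add: degree_le_def b_def)
      show "\<forall>y\<in>hypercube V. \<bar>walsh_sum V b y\<bar> \<le> 1"
      proof
        fix y assume y: "y \<in> hypercube V"
        have "walsh_sum V b y = (\<Sum>T\<in>TT. walsh T y * D T x) / A"
          unfolding walsh_sum_def sum_divide_distrib TT_def using V
          by (intro sum.mono_neutral_cong_right) (auto simp: b_def)
        moreover have "\<bar>\<Sum>T\<in>TT. walsh T y * D T x\<bar> \<le> A"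
          unfolding D A_def TT_def \<rho>_def using k by (intro Taylor_bound V bound x y) auto
        ultimately show "\<bar>walsh_sum V b y\<bar> \<le> 1"
          using A by (simp add: divide_le_eq)
      qed
    qed (use V in auto)
    also have "(\<Sum>T\<in>Pow V. \<bar>b T\<bar> powr p) = (\<Sum>T\<in>TT. (\<bar>D T x\<bar> / A) powr p)"
      unfolding TT_def using V A by (intro sum.mono_neutral_cong_right) (auto simp: b_def)
    also have "\<dots> = (\<Sum>T\<in>TT. \<bar>D T x\<bar> powr p) / A powr p"
      using A by (simp add: powr_divide sum_divide_distrib)
    finally show ?thesis
      using A coeff_bound(2) by (simp add: powr_mult divide_simps)
  qed
  have "(\<Sum>T\<in>TT. (\<Sum>S\<in>{S\<in>Pow V. T \<subseteq> S}. (a S)\<^sup>2) powr (real k / (real k + 1))) \<le>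
      (\<Sum>T\<in>TT. 9 powr (1 + real d / (real k + 1)) * mean V (\<lambda>x. \<bar>D T x\<bar> powr p))"
    by (intro sum_mono single)
  \<comment> \<open>With the sum inside the mean, \<open>point\<close> applies at every
    \<open>x\<close> separately.\<close>
  also have "\<dots> = 9 powr (1 + real d / (real k + 1)) * mean V (\<lambda>x. \<Sum>T\<in>TT. \<bar>D T x\<bar> powr p)"
    by (simp add: mean_sum flip: sum_distrib_left)
  also have "\<dots> \<le> 9 powr (1 + real d / (real k + 1)) * mean V (\<lambda>x. (B * A) powr p)"
    by (intro mult_left_mono mean_mono point) auto
  finally show ?thesis
    using V by (simp add: TT_def p_def A_def)
qed

text \<open>Greedy choice: the last block takes as many elements as its size allows. Small sets get
  smaller or empty blocks; the union recovers \<open>S\<close>, so the blocks determine it.\<close>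

lemma partition_into_blocks:
  fixes \<kappa> :: "nat \<Rightarrow> nat"
  assumes "finite S" "card S \<le> (\<Sum>j<m. \<kappa> j)"
  shows "\<exists>T. (\<forall>j<m. T j \<subseteq> S \<and> card (T j) \<le> \<kappa> j) \<and> (\<Union>j<m. T j) = S"
  using assms
proof (induction m arbitrary: S)
  case (Suc m)
  obtain A where A: "A \<subseteq> S" "card A = min (card S) (\<kappa> m)"
    using Suc.prems(1) by (meson min.cobounded1 obtain_subset_with_card_n)
  have "card (S - A) = card S - card A"
    using A Suc.prems(1) by (meson card_Diff_subset finite_subset)
  then have "card (S - A) \<le> (\<Sum>j<m. \<kappa> j)"
    using Suc.prems A by simp
  then obtain T where T: "\<forall>j<m. T j \<subseteq> S - A \<and> card (T j) \<le> \<kappa> j" "(\<Union>j<m. T j) = S - A"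
    using Suc.IH[of "S - A"] Suc.prems(1) by blast
  have "(\<Union>j<Suc m. (T(m := A)) j) = S"
    using T(2) A(1) by (auto simp: lessThan_Suc)
  moreover have "\<forall>j<Suc m. (T(m := A)) j \<subseteq> S \<and> card ((T(m := A)) j) \<le> \<kappa> j"
    using T(1) A by (auto simp: less_Suc_eq)
  ultimately show ?case by blast
qed auto

text \<open>\<open>Blei_partition\<close> with \<open>q\<close> the squared coefficients: sets whose
  \<open>j\<close>-th block is \<open>T\<close> contain \<open>T\<close>, so the sum over all
  supersets of \<open>T\<close> can serve as \<open>u T\<close>.\<close>

lemma coeff_bound_step:
  fixes \<kappa> :: "nat \<Rightarrow> nat" and \<beta> :: "nat \<Rightarrow> real"
  assumes d: "d \<ge> 1" "(\<Sum>j<m. \<kappa> j) = d" and W: "W \<ge> 1"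
    and \<kappa>: "\<And>j. j < m \<Longrightarrow> \<kappa> j \<ge> 1" "\<And>j. j < m \<Longrightarrow> coeff_bound (\<kappa> j) (\<beta> j)" "\<And>j. j < m \<Longrightarrow> \<beta> j \<ge> 0"
    and le: "\<And>j. j < m \<Longrightarrow> 9 powr (1 + real d / (real (\<kappa> j) + 1)) *
      (\<beta> j * Taylor_const d (\<kappa> j)) powr (2 * real (\<kappa> j) / (real (\<kappa> j) + 1)) \<le> W"
  shows "coeff_bound d W"
  unfolding coeff_bound_def
proof (intro allI impI)
  fix V :: "nat set" and a
  assume V: "finite V" "degree_le d V a" and bound: "\<forall>x\<in>hypercube V. \<bar>walsh_sum V a x\<bar> \<le> 1"
  define F where "F = {S\<in>Pow V. card S \<le> d}"
  define P where "P S T \<longleftrightarrow> (\<forall>j<m. T j \<subseteq> S \<and> card (T j) \<le> \<kappa> j) \<and> (\<Union>j<m. T j) = S" for S and T :: "nat \<Rightarrow> nat set"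
  have "\<exists>T. P S T" if "S \<in> F" for S
    unfolding P_def using that V(1) d(2) by (intro partition_into_blocks) (auto simp: F_def intro: finite_subset)
  then obtain \<T> where \<T>: "\<And>S. S \<in> F \<Longrightarrow> P S (\<T> S)"
    by metis
  have "(\<Sum>S\<in>F. ((a S)\<^sup>2) powr (real d / (real d + 1))) \<le> W powr (2 * real d / (real d + 1))"
  proof (rule Blei_partition[where \<kappa> = \<kappa> and m = m and T = "\<lambda>j S. \<T> S j"
        and B = "\<lambda>j. {T\<in>Pow V. card T \<le> \<kappa> j}" and u = "\<lambda>T. \<Sum>S\<in>{S\<in>Pow V. T \<subseteq> S}. (a S)\<^sup>2"])
    fix j S assume "j < m" "S \<in> F"
    then show "\<T> S j \<in> {T\<in>Pow V. card T \<le> \<kappa> j}"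
      using \<T>[of S] by (auto simp: P_def F_def)
  next
    fix S S' assume "S \<in> F" "S' \<in> F" "\<And>j. j < m \<Longrightarrow> \<T> S j = \<T> S' j"
    then show "S = S'"
      using \<T>[of S] \<T>[of S'] unfolding P_def by (metis (no_types, lifting) SUP_cong lessThan_iff)
  next
    fix j t assume j: "j < m" and "t \<in> {T\<in>Pow V. card T \<le> \<kappa> j}"
    show "(\<Sum>S\<in>{S\<in>F. \<T> S j = t}. (a S)\<^sup>2) \<le> (\<Sum>S\<in>{S\<in>Pow V. t \<subseteq> S}. (a S)\<^sup>2)"
    proof (rule sum_mono2)
      show "{S\<in>F. \<T> S j = t} \<subseteq> {S\<in>Pow V. t \<subseteq> S}"
      proof
        fix S assume "S \<in> {S\<in>F. \<T> S j = t}"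
        then show "S \<in> {S\<in>Pow V. t \<subseteq> S}"
          using \<T>[of S] j by (auto simp: P_def F_def)
      qed
    qed (use V in auto)
  next
    fix j assume j: "j < m"
    have "\<kappa> j \<le> d"
      using j d(2) by (metis finite_lessThan lessThan_iff member_le_sum zero_le)
    then have "(\<Sum>T\<in>{T\<in>Pow V. card T \<le> \<kappa> j}. (\<Sum>S\<in>{S\<in>Pow V. T \<subseteq> S}. (a S)\<^sup>2) powr (real (\<kappa> j) / (real (\<kappa> j) + 1)))
      \<le> 9 powr (1 + real d / (real (\<kappa> j) + 1)) * (\<beta> j * Taylor_const d (\<kappa> j)) powr (2 * real (\<kappa> j) / (real (\<kappa> j) + 1))"
      using j \<kappa> V bound by (intro block_sum_le) auto
    also have "\<dots> \<le> W"
      using j by (rule le)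
    finally show "(\<Sum>T\<in>{T\<in>Pow V. card T \<le> \<kappa> j}. (\<Sum>S\<in>{S\<in>Pow V. T \<subseteq> S}. (a S)\<^sup>2) powr (real (\<kappa> j) / (real (\<kappa> j) + 1))) \<le> W" .
  qed (use V d \<kappa> W in \<open>auto simp: F_def\<close>)
  also have "(\<Sum>S\<in>F. ((a S)\<^sup>2) powr (real d / (real d + 1))) = (\<Sum>S\<in>Pow V. \<bar>a S\<bar> powr (2 * real d / (real d + 1)))"
  proof (rule sum.mono_neutral_cong_left)
    show "((a S)\<^sup>2) powr (real d / (real d + 1)) = \<bar>a S\<bar> powr (2 * real d / (real d + 1))" for S
    proof (cases "a S = 0")
      case False
      then have "(a S)\<^sup>2 = \<bar>a S\<bar> powr 2"
        by (simp add: powr_numeral)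
      then show ?thesis
        by (simp only: powr_powr) (simp add: mult.commute)
    qed simp
  qed (use V in \<open>auto simp: F_def degree_le_def not_le\<close>)
  finally show "(\<Sum>S\<in>Pow V. \<bar>a S\<bar> powr (2 * real d / (real d + 1))) \<le> W powr (2 * real d / (real d + 1))" .
qed

section \<open>Bohnenblust--Hille constants\<close>

lemma coeff_bound_mono:
  assumes "coeff_bound d B" "0 \<le> B" "B \<le> B'"
  shows "coeff_bound d B'"
proof -
  have "B powr (2 * real d / (real d + 1)) \<le> B' powr (2 * real d / (real d + 1))"
    using assms by (intro powr_mono2) auto
  then show ?thesis
    using assms(1) unfolding coeff_bound_def by (meson order_trans)
qed

text \<open>For degree \<open>1\<close> the exponent is \<open>1\<close>, and matching signs makes
  all terms add up in absolute value.\<close>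

lemma coeff_bound_1: "coeff_bound 1 1"
  unfolding coeff_bound_def
proof (intro allI impI)
  fix V :: "nat set" and a
  assume V: "finite V" "degree_le 1 V a" and bound: "\<forall>x\<in>hypercube V. \<bar>walsh_sum V a x\<bar> \<le> 1"
  define s :: real where "s = (if a {} < 0 then - 1 else 1)"
  \<comment> \<open>Signs are taken relative to the constant term. A zero coefficient gives
    \<open>z i = 0\<close>, so \<open>z\<close> is only known to lie in the solid cube.\<close>
  define z where "z i = s * sgn (a {i})" for i
  have "a S * walsh S z = s * \<bar>a S\<bar>" if S: "S \<in> Pow V" for S
  proof -
    have fin: "finite S"
      using S V(1) finite_subset by auto
    consider "card S = 0" | "card S = 1" | "card S > 1"
      by linarith
    then show ?thesis
    proof cases
      case 1
      then show ?thesis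
        using fin by (simp add: walsh_def s_def)
    next
      case 2
      then obtain i where "S = {i}"
        by (auto simp: card_1_singleton_iff)
      then show ?thesis
        by (simp add: walsh_def z_def abs_sgn)
    next
      case 3
      then show ?thesis
        using V(2) S by (simp add: degree_le_def)
    qed
  qed
  then have "walsh_sum V a z = s * (\<Sum>S\<in>Pow V. \<bar>a S\<bar>)"
    unfolding walsh_sum_def sum_distrib_left by (rule sum.cong[OF refl])
  moreover have "\<bar>walsh_sum V a z\<bar> \<le> 1"
    using V(1) by (rule walsh_sum_le_on_solid_cube) (use bound in \<open>auto simp: z_def s_def abs_mult sgn_if\<close>)
  ultimately have "(\<Sum>S\<in>Pow V. \<bar>a S\<bar>) \<le> 1"
    by (simp add: s_def split: if_splits)
  then show "(\<Sum>S\<in>Pow V. \<bar>a S\<bar> powr (2 * real 1 / (real 1 + 1))) \<le> 1 powr (2 * real 1 / (real 1 + 1))"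
    by simp
qed

text \<open>With \<open>d\<close> singleton blocks, moment comparison costs \<open>9 * 3 ^ d\<close>
  and the Taylor bound is polynomial in \<open>d\<close>, here estimated by
  \<open>12 * 4 ^ d\<close>; \<open>1296 = 108 * 12\<close>.\<close>

lemma coeff_bound_exponential:
  assumes "d \<ge> 1"
  shows "coeff_bound d (1296 ^ d)"
proof (rule coeff_bound_step[where m = d and \<kappa> = "\<lambda>_. 1" and \<beta> = "\<lambda>_. 1"])
  have "9 powr (1 + real d / 2) = 9 * (9 powr (1 / 2)) powr real d"
    by (simp only: powr_powr powr_add) simp
  also have "(9 :: real) powr (1 / 2) = 3"
    by (simp add: powr_half_sqrt real_sqrt_eq_iff[of 9 "3\<^sup>2", simplified])
  finally have nine: "9 powr (1 + real d / 2) = 9 * 3 ^ d"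
    by (simp add: powr_realpow)
  have "real d \<le> 2 ^ d" "real d + 1 \<le> 2 ^ d"
    using less_exp[of d] Suc_leI[OF less_exp[of d]]
    by (metis of_nat_le_iff of_nat_numeral of_nat_power less_imp_le)
       (metis Suc_leI less_exp of_nat_Suc of_nat_le_iff of_nat_numeral of_nat_power add.commute)
  then have "Taylor_const d 1 \<le> 12 * (2 ^ d * 2 ^ d)"
    unfolding Taylor_const_def by (simp add: mult_mono)
  also have "\<dots> = 12 * 4 ^ d"
    by (simp flip: power_mult_distrib)
  finally have "9 powr (1 + real d / 2) * Taylor_const d 1 \<le> 9 * 3 ^ d * (12 * 4 ^ d)"
    unfolding nine by (intro mult_left_mono) auto
  also have "\<dots> = 108 * 12 ^ d"
    by (simp flip: power_mult_distrib)
  also have "\<dots> \<le> 108 ^ d * 12 ^ d"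
    using assms self_le_power[of "108 :: real" d] by simp
  also have "\<dots> = (1296 :: real) ^ d"
    by (simp flip: power_mult_distrib)
  finally show "9 powr (1 + real d / (real 1 + 1)) * (1 * Taylor_const d 1) powr (2 * real 1 / (real 1 + 1)) \<le> 1296 ^ d"
    using Taylor_const_pos[OF assms, of 1] by simp
qed (use assms coeff_bound_1 in auto)

lemma Taylor_const_ge_1:
  assumes "d \<ge> 1"
  shows "Taylor_const d k \<ge> 1"
proof -
  have "4 * real d * (real d + 1) \<ge> 1"
    using assms mult_mono[of 1 "4 * real d" 1 "real d + 1"] by simp
  then show ?thesis
    using one_le_power[of "4 * real d * (real d + 1)" k] unfolding Taylor_const_def by linarith
qed

lemma Taylor_const_mono:
  assumes "d \<ge> 1" "k \<le> l"
  shows "Taylor_const d k \<le> Taylor_const d l"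
proof -
  have "4 * real d * (real d + 1) \<ge> 1"
    using assms mult_mono[of 1 "4 * real d" 1 "real d + 1"] by simp
  then show ?thesis
    using assms(2) unfolding Taylor_const_def by (intro mult_left_mono power_increasing) auto
qed

lemma coeff_bound_blocks:
  assumes k: "1 \<le> k" "k \<le> d"
  shows "coeff_bound d (9 powr (1 + real d / real k) * (1296 ^ (2 * k) * Taylor_const d (2 * k))\<^sup>2)" (is "coeff_bound d ?W")
proof -
  define m where "m = d div k"
  \<comment> \<open>The first block absorbs the remainder of \<open>d\<close> modulo
    \<open>k\<close>, which keeps all sizes between \<open>k\<close> and
    \<open>2 * k\<close>.\<close>
  define \<kappa> where "\<kappa> j = (if j = 0 then k + d mod k else k)" for j :: nat
  define Y where "Y = 1296 ^ (2 * k) * Taylor_const d (2 * k)"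
  have "m \<ge> 1"
    using k by (simp add: m_def div_greater_zero_iff Suc_leI)
  have \<kappa>: "k \<le> \<kappa> j" "\<kappa> j \<le> 2 * k" for j
    using k mod_less_divisor[of k d] by (auto simp: \<kappa>_def)
  have T: "Taylor_const d (2 * k) \<ge> 1"
    using k by (intro Taylor_const_ge_1) auto
  have "1 * 1 \<le> Y"
    unfolding Y_def using T by (intro mult_mono) auto
  then have Y: "1 \<le> Y"
    by simp
  have "1 * 1 \<le> 9 powr (1 + real d / real k) * Y\<^sup>2"
    using Y by (intro mult_mono) (auto intro!: ge_one_powr_ge_zero)
  then have W: "1 \<le> ?W"
    by (simp add: Y_def)
  show ?thesis
  proof (rule coeff_bound_step[where m = m and \<kappa> = \<kappa> and \<beta> = "\<lambda>j. 1296 ^ \<kappa> j"])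
    have "{..<m} = insert 0 {1..<m}"
      using \<open>m \<ge> 1\<close> by auto
    then have "(\<Sum>j<m. \<kappa> j) = (k + d mod k) + (\<Sum>j\<in>{1..<m}. \<kappa> j)"
      by (simp add: \<kappa>_def)
    also have "(\<Sum>j\<in>{1..<m}. \<kappa> j) = (m - 1) * k"
      by (simp add: \<kappa>_def)
    also have "(k + d mod k) + (m - 1) * k = m * k + d mod k"
      using \<open>m \<ge> 1\<close> by (cases m) auto
    finally show "(\<Sum>j<m. \<kappa> j) = d"
      by (simp add: m_def)
  next
    fix j assume "j < m"
    show "coeff_bound (\<kappa> j) (1296 ^ \<kappa> j)"
      using k \<kappa>(1)[of j] by (intro coeff_bound_exponential) auto
    have "real d / (real (\<kappa> j) + 1) \<le> real d / real k"
      using k \<kappa>(1)[of j] by (intro divide_left_mono) auto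
    then have one: "9 powr (1 + real d / (real (\<kappa> j) + 1)) \<le> 9 powr (1 + real d / real k)"
      by (intro powr_mono) auto
    have "(1 :: real) * 1 \<le> 1296 ^ \<kappa> j * Taylor_const d (\<kappa> j)"
      using k by (intro mult_mono Taylor_const_ge_1) auto
    then have ge: "1 \<le> 1296 ^ \<kappa> j * Taylor_const d (\<kappa> j)"
      by simp
    \<comment> \<open>The exponent \<open>2k/(k+1)\<close> is below \<open>2\<close>, and the base
      is at least \<open>1\<close>; this is the origin of the square in \<open>?W\<close>.\<close>
    have "(1296 ^ \<kappa> j * Taylor_const d (\<kappa> j)) powr (2 * real (\<kappa> j) / (real (\<kappa> j) + 1)) \<le>
        (1296 ^ \<kappa> j * Taylor_const d (\<kappa> j)) powr 2"
      using ge by (intro powr_mono) (auto simp: divide_simps)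
    also have "\<dots> \<le> Y powr 2"
      unfolding Y_def using k \<kappa>(2)[of j] Taylor_const_ge_1[of d "\<kappa> j"]
      by (intro powr_mono2 mult_mono power_increasing Taylor_const_mono) auto
    also have "\<dots> = Y\<^sup>2"
      using Y by (simp add: powr_numeral)
    finally show "9 powr (1 + real d / (real (\<kappa> j) + 1)) *
        (1296 ^ \<kappa> j * Taylor_const d (\<kappa> j)) powr (2 * real (\<kappa> j) / (real (\<kappa> j) + 1)) \<le> ?W"
      using one unfolding Y_def by (intro mult_mono) auto
    show "1 \<le> \<kappa> j"
      using k \<kappa>(1)[of j] by simp
  qed (use k W in auto)
qed

text \<open>The exponent collects the coefficients of \<open>s\<close> in the final estimate of
  \<open>ln W\<close>.\<close>

definition BH_base :: real where
  "BH_base = exp (2 * ln 9 + 16 * ln 1296 + 2 * ln 3 + 16 * ln 8 + 16)"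

lemma BH_base_ge_1: "BH_base \<ge> 1"
  by (simp add: BH_base_def)

text \<open>Blocks of size \<open>k \<approx> sqrt (d / ln d)\<close> balance the factors \<open>9 powr (d / k)\<close> and \<open>d ^ O(k)\<close>.\<close>
lemma coeff_bound_subexponential:
  assumes "d \<ge> 1"
  shows "coeff_bound d (BH_base powr sqrt (real d * ln (real d)))"
proof (cases "d = 1")
  \<comment> \<open>Here \<open>ln (real d) = 0\<close>, so the constant is
    \<open>1\<close>.\<close>
  case True
  then show ?thesis
    using coeff_bound_1 BH_base_ge_1 by simp
next
  case False
  then have d: "d \<ge> 2"
    using assms by simp
  define L where "L = ln (real d)"
  define s where "s = sqrt (real d * L)"
  \<comment> \<open>At this \<open>r\<close> both \<open>d / r\<close> and \<open>r * L\<close>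
    equal \<open>s\<close>; rounding up to \<open>k\<close> at most doubles \<open>r\<close>, since
    \<open>r \<ge> 1\<close>.\<close>
  define r where "r = sqrt (real d / L)"
  define k where "k = nat \<lceil>r\<rceil>"
  have "1 / 2 \<le> ln (2 :: real)"
    using ln2_ge_two_thirds by simp
  also have "ln 2 \<le> L"
    unfolding L_def using d by simp
  finally have L: "1 / 2 \<le> L" .
  have "L \<le> real d - 1"
    unfolding L_def using d by (intro ln_le_minus_one) simp
  then have "1 \<le> real d / L"
    using L by (simp add: field_simps)
  then have r1: "1 \<le> r"
    by (simp add: r_def)
  have "real d / L \<le> real d * real d"
  proof -
    have "1 / L \<le> 1 / (1 / 2)"
      using L by (intro divide_left_mono) auto
    then have "1 / L \<le> real d"
      using d by simp
    then have "real d * (1 / L) \<le> real d * real d"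
      by (intro mult_left_mono) auto
    then show ?thesis by simp
  qed
  then have "r \<le> sqrt (real d * real d)"
    unfolding r_def by (rule real_sqrt_le_mono)
  then have rd: "r \<le> real d"
    by simp
  have rL: "r * L = s"
  proof -
    have "r * L = sqrt (real d / L) * sqrt (L * L)"
      using L by (simp add: r_def)
    also have "\<dots> = s"
      using L unfolding s_def real_sqrt_mult[symmetric] by simp
    finally show ?thesis .
  qed
  have rs: "real d = s * r"
    using L by (simp add: s_def r_def flip: real_sqrt_mult)
  have k: "r \<le> real k" "real k \<le> 2 * r" "1 \<le> k" "k \<le> d"
  proof -
    show "r \<le> real k"
      unfolding k_def by (rule real_nat_ceiling_ge)
    have "real k < r + 1"
      unfolding k_def using r1 by linarith
    then show "real k \<le> 2 * r"
      using r1 by linarith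
    show "1 \<le> k"
      using \<open>r \<le> real k\<close> r1 by linarith
    show "k \<le> d"
      unfolding k_def using rd by (simp add: ceiling_le_iff nat_le_iff)
  qed
  have dk: "real d / real k \<le> s"
  proof -
    have "s * r \<le> s * real k"
      using k L by (intro mult_left_mono) (auto simp: s_def)
    then show ?thesis
      using rs k by (simp add: divide_le_eq)
  qed
  have kL: "real k * L \<le> 2 * s"
    using mult_right_mono[OF k(2), of L] L by (simp flip: rL)
  \<comment> \<open>Terms in \<open>k\<close> without a logarithm are of order \<open>s\<close> as
    well, because \<open>L \<ge> 1 / 2\<close>.\<close>
  have "real k * (1 / 2) \<le> real k * L"
    using L by (intro mult_left_mono) auto
  then have ks: "real k \<le> 4 * s"
    using kL by linarith
  have s1: "1 \<le> s"
    unfolding s_def using d L mult_mono[of 2 "real d" "1 / 2" L] by simp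
  define W where "W = 9 powr (1 + real d / real k) * (1296 ^ (2 * k) * Taylor_const d (2 * k))\<^sup>2"
  have T: "Taylor_const d (2 * k) > 0"
    using d by (intro Taylor_const_pos) auto
  have W0: "W > 0"
    unfolding W_def using T by simp
  have lnT: "ln (Taylor_const d (2 * k)) \<le> ln 3 + 2 * real k * (ln 8 + 2 * L)"
  proof -
    have "4 * real d * (real d + 1) \<le> 4 * real d * (2 * real d)"
      using d by (intro mult_left_mono) auto
    then have "ln (4 * real d * (real d + 1)) \<le> ln (8 * (real d)\<^sup>2)"
      using d by (intro ln_mono) (auto simp: power2_eq_square)
    also have "\<dots> = ln 8 + 2 * L"
      using d by (simp add: ln_mult ln_realpow L_def)
    finally have "2 * real k * ln (4 * real d * (real d + 1)) \<le> 2 * real k * (ln 8 + 2 * L)"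
      by (intro mult_left_mono) auto
    moreover have "ln (Taylor_const d (2 * k)) = ln 3 + 2 * real k * ln (4 * real d * (real d + 1))"
      unfolding Taylor_const_def using d by (subst ln_mult) (auto simp: ln_realpow)
    ultimately show ?thesis by simp
  qed
  have "ln W = (1 + real d / real k) * ln 9 + 2 * (2 * real k * ln 1296 + ln (Taylor_const d (2 * k)))"
    unfolding W_def using T by (simp add: ln_mult ln_powr ln_realpow)
  also have "\<dots> \<le> (1 + real d / real k) * ln 9 + 2 * (2 * real k * ln 1296 + (ln 3 + 2 * real k * (ln 8 + 2 * L)))"
    using lnT by simp
  also have "\<dots> = (1 + real d / real k) * ln 9 + real k * (4 * ln 1296 + 4 * ln 8) + 1 * (2 * ln 3) + (real k * L) * 8"
    by (simp add: algebra_simps)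
  also have "\<dots> \<le> (2 * s) * ln 9 + (4 * s) * (4 * ln 1296 + 4 * ln 8) + s * (2 * ln 3) + (2 * s) * 8"
    using s1 dk ks kL by (intro add_mono mult_right_mono) auto
  also have "\<dots> = s * ln BH_base"
    by (simp add: BH_base_def algebra_simps)
  finally have "exp (ln W) \<le> exp (s * ln BH_base)"
    by simp
  then have "W \<le> BH_base powr s"
    using W0 BH_base_ge_1 by (simp add: powr_def)
  moreover have "coeff_bound d W"
    unfolding W_def using k by (intro coeff_bound_blocks) auto
  ultimately show ?thesis
    using W0 unfolding s_def L_def by (metis coeff_bound_mono less_imp_le)
qed

section \<open>Functions on the cube and the best constant\<close>

lemma cube_eq: "cube n = hypercube {1..n}"
  by (simp add: cube_def hypercube_def)

text \<open>The sum factors as the product of the \<open>1 + x i * y i\<close>, and a coordinate in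
  which \<open>x\<close> and \<open>y\<close> differ makes a factor vanish.\<close>

lemma walsh_mult_self:
  assumes x: "x \<in> hypercube V" and y: "y \<in> hypercube V" and "finite V"
  shows "(\<Sum>S\<in>Pow V. walsh S x * walsh S y) = (if x = y then 2 ^ card V else 0)"
proof -
  have "(\<Sum>S\<in>Pow V. walsh S x * walsh S y) = (\<Prod>i\<in>V. x i * y i + 1)"
    using \<open>finite V\<close> by (subst prod_add) (auto simp: walsh_def prod.distrib)
  also have "\<dots> = (if x = y then 2 ^ card V else 0)"
  proof (cases "x = y")
    case True
    have "x i * x i + 1 = 2" if "i \<in> V" for i
      using abs_hypercube[OF x that] by (metis abs_mult_self_eq mult_1 one_add_one)
    then show ?thesis
      using True by simp
  next
    case False
    then obtain i where i: "i \<in> V" "x i \<noteq> y i"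
      using x y unfolding hypercube_def by (meson PiE_ext)
    then have "x i * y i + 1 = 0"
      using abs_hypercube[OF x i(1)] abs_hypercube[OF y i(1)] by (auto simp: abs_if split: if_splits)
    then show ?thesis
      using False i \<open>finite V\<close> by (auto intro!: prod_zero)
  qed
  finally show ?thesis .
qed

lemma walsh_expansion:
  assumes x: "x \<in> cube n"
  shows "walsh_sum {1..n} (fourier_coeff n f) x = f x"
proof -
  have "walsh_sum {1..n} (fourier_coeff n f) x =
      (\<Sum>S\<in>Pow {1..n}. \<Sum>y\<in>cube n. f y / 2 ^ n * (walsh S y * walsh S x))"
    by (simp add: walsh_sum_def fourier_coeff_def sum_distrib_right sum_distrib_left sum_divide_distrib mult_ac)
  also have "\<dots> = (\<Sum>y\<in>cube n. f y / 2 ^ n * (\<Sum>S\<in>Pow {1..n}. walsh S y * walsh S x))"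
    by (subst sum.swap) (simp add: sum_distrib_left)
  also have "\<dots> = (\<Sum>y\<in>cube n. if y = x then f y else 0)"
    using x by (intro sum.cong refl) (simp add: cube_eq walsh_mult_self)
  also have "\<dots> = f x"
    using x by (simp add: cube_eq)
  finally show ?thesis .
qed

lemma cube_sup_norm_upper: "x \<in> cube n \<Longrightarrow> \<bar>f x\<bar> \<le> cube_sup_norm n f"
  unfolding cube_sup_norm_def by (intro Max_ge) (auto simp: cube_eq)

lemma cube_nonempty: "cube n \<noteq> {}"
  by (simp add: cube_def PiE_eq_empty_iff)

lemma cube_sup_norm_nonneg: "cube_sup_norm n f \<ge> 0"
  using cube_nonempty cube_sup_norm_upper by (metis abs_ge_zero ex_in_conv order_trans)

text \<open>By homogeneity the function may be divided by its sup norm; if that norm is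
  \<open>0\<close>, all coefficients vanish.\<close>

lemma BH_bound_of_coeff_bound:
  assumes "coeff_bound d B" "B \<ge> 0" "d \<ge> 1"
  shows "BH_bound d B"
  unfolding BH_bound_def
proof (intro allI impI)
  fix n f assume f: "degree_at_most n d f"
  define M where "M = cube_sup_norm n f"
  define p where "p = 2 * real d / (real d + 1)"
  define c where "c = fourier_coeff n f"
  define I where "I = {S. S \<subseteq> {1..n} \<and> card S \<le> d}"
  have norm: "coeff_norm n d f = (\<Sum>S\<in>I. \<bar>c S\<bar> powr p) powr (1 / p)"
    by (simp add: coeff_norm_def p_def c_def I_def)
  have p: "p > 0"
    using assms(3) by (simp add: p_def)
  have "coeff_norm n d f \<le> B * M"
  proof (cases "M = 0")
    case True
    then have "f x = 0" if "x \<in> cube n" for x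
      using cube_sup_norm_upper[OF that, of f] by (simp add: M_def)
    then have "c S = 0" for S
      by (simp add: c_def fourier_coeff_def)
    then show ?thesis
      using True unfolding norm by simp
  next
    case False
    then have M: "M > 0"
      using cube_sup_norm_nonneg[of n f] by (simp add: M_def)
    define a where "a S = c S / M" for S
    have "(\<Sum>S\<in>Pow {1..n}. \<bar>a S\<bar> powr p) \<le> B powr p"
      using assms(1) unfolding coeff_bound_def p_def
    proof (elim allE impE)
      show "degree_le d {1..n} a"
        using f by (simp add: degree_le_def degree_at_most_def a_def c_def)
      show "\<forall>x\<in>hypercube {1..n}. \<bar>walsh_sum {1..n} a x\<bar> \<le> 1"
      proof
        fix x assume "x \<in> hypercube {1..n}"
        then have x: "x \<in> cube n"
          by (simp add: cube_eq)
        have "walsh_sum {1..n} a x = walsh_sum {1..n} c x / M"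
          by (simp add: walsh_sum_def a_def sum_divide_distrib)
        also have "\<dots> = f x / M"
          unfolding c_def by (simp only: walsh_expansion[OF x])
        finally show "\<bar>walsh_sum {1..n} a x\<bar> \<le> 1"
          using M cube_sup_norm_upper[OF x, of f] by (simp add: M_def)
      qed
    qed auto
    moreover have "(\<Sum>S\<in>I. \<bar>a S\<bar> powr p) \<le> (\<Sum>S\<in>Pow {1..n}. \<bar>a S\<bar> powr p)"
      by (intro sum_mono2) (auto simp: I_def)
    moreover have "(\<Sum>S\<in>I. \<bar>c S\<bar> powr p) = (\<Sum>S\<in>I. \<bar>a S\<bar> powr p) * M powr p"
      using M by (simp add: a_def powr_divide flip: sum_divide_distrib)
    ultimately have "(\<Sum>S\<in>I. \<bar>c S\<bar> powr p) \<le> B powr p * M powr p"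
      by (simp add: mult_right_mono)
    also have "\<dots> = (B * M) powr p"
      using M assms(2) by (simp add: powr_mult)
    finally have "(\<Sum>S\<in>I. \<bar>c S\<bar> powr p) powr (1 / p) \<le> ((B * M) powr p) powr (1 / p)"
      using p by (intro powr_mono2) (auto intro: sum_nonneg)
    also have "\<dots> = B * M"
      using p M assms(2) by (simp add: powr_powr)
    finally show ?thesis
      unfolding norm .
  qed
  then show "coeff_norm n d f \<le> B * cube_sup_norm n f"
    by (simp add: M_def)
qed

text \<open>Tested on the constant \<open>1\<close> in one variable. This bounds the admissible
  constants from below and yields the lower half of the limit.\<close>

lemma BH_bound_ge_1:
  assumes "BH_bound d K" "d \<ge> 1"
  shows "K \<ge> 1"
proof -
  define f :: "(nat \<Rightarrow> real) \<Rightarrow> real" where "f = (\<lambda>_. 1)"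
  define I where "I = {S. S \<subseteq> {1..1::nat} \<and> card S \<le> d}"
  have fin: "finite I"
    unfolding I_def by auto
  have "degree_at_most 1 d f"
    unfolding degree_at_most_def
  proof (intro allI impI)
    fix S assume S: "S \<subseteq> {1..1::nat} \<and> card S > d"
    then have "card S \<le> 1"
      using card_mono[of "{1..1::nat}" S] by simp
    with S assms(2) show "fourier_coeff 1 f S = 0"
      by linarith
  qed
  then have le: "coeff_norm 1 d f \<le> K * cube_sup_norm 1 f"
    using assms(1) by (auto simp: BH_bound_def)
  have "fourier_coeff 1 f {} = 1"
    by (simp add: fourier_coeff_def f_def walsh_def cube_eq card_hypercube)
  then have "1 \<le> (\<Sum>S\<in>I. \<bar>fourier_coeff 1 f S\<bar> powr (2 * real d / (real d + 1)))"
    using fin member_le_sum[of "{}" I "\<lambda>S. \<bar>fourier_coeff 1 f S\<bar> powr (2 * real d / (real d + 1))"]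
    by (simp add: I_def)
  then have "1 \<le> coeff_norm 1 d f"
    unfolding coeff_norm_def I_def by (intro ge_one_powr_ge_zero) auto
  moreover have "cube_sup_norm 1 f = 1"
    unfolding cube_sup_norm_def f_def using cube_nonempty[of 1] by (simp add: image_constant_conv)
  ultimately show ?thesis
    using le by simp
qed

text \<open>For each \<open>f\<close> the condition on \<open>K\<close> is a closed inequality, so
  the infimum of the admissible constants is admissible. Hence the least element in the definition
  of \<open>BH\<close> exists.\<close>

lemma BH_bound_BH:
  assumes "BH_bound d B" "d \<ge> 1"
  shows "BH d \<le> B" "BH_bound d (BH d)"
proof -
  define I where "I = Inf {K. BH_bound d K}"
  have bdd: "bdd_below {K. BH_bound d K}"
    using BH_bound_ge_1[OF _ assms(2)] by (intro bdd_belowI[of _ 1]) auto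
  have le: "I \<le> K" if "BH_bound d K" for K
    unfolding I_def using that bdd by (intro cInf_lower) auto
  have bound: "BH_bound d I"
    unfolding BH_bound_def
  proof (intro allI impI)
    fix n f assume f: "1 \<le> n" "degree_at_most n d f"
    have *: "coeff_norm n d f \<le> K * cube_sup_norm n f" if "BH_bound d K" for K
      using that f by (auto simp: BH_bound_def)
    show "coeff_norm n d f \<le> I * cube_sup_norm n f"
    proof (cases "cube_sup_norm n f = 0")
      case True
      then show ?thesis
        using *[OF assms(1)] by simp
    next
      case False
      then have pos: "cube_sup_norm n f > 0"
        using cube_sup_norm_nonneg[of n f] by simp
      have "coeff_norm n d f / cube_sup_norm n f \<le> I"
        unfolding I_def using assms(1) * pos by (intro cInf_greatest) (auto simp: divide_le_eq)
      then show ?thesis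
        using pos by (simp add: divide_le_eq)
    qed
  qed
  have "BH d = I"
    unfolding BH_def using bound le by (rule Least_equality)
  then show "BH d \<le> B" "BH_bound d (BH d)"
    using le[OF assms(1)] bound by simp_all
qed

theorem theorem1p1:
  shows "(\<exists>C::real. C > 0 \<and>
            (\<forall>d::nat. d \<ge> 1 \<longrightarrow> BH d \<le> C powr sqrt (real d * ln (real d))) \<and>
            (\<forall>(d::nat) (n::nat) (f :: (nat \<Rightarrow> real) \<Rightarrow> real).
               d \<ge> 1 \<longrightarrow> n \<ge> 1 \<longrightarrow> degree_at_most n d f \<longrightarrow>
               (\<Sum>S\<in>{S. S \<subseteq> {1..n} \<and> card S \<le> d}.
                  \<bar>fourier_coeff n f S\<bar> powr (2 * real d / (real d + 1)))
               powr ((real d + 1) / (2 * real d))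
               \<le> C powr sqrt (real d * ln (real d)) * Max ((\<lambda>x. \<bar>f x\<bar>) ` cube n)))
       \<and> limsup (\<lambda>d. ereal (root d (BH d))) = 1"
proof -
  have bound: "BH_bound d (BH_base powr sqrt (real d * ln (real d)))" if "d \<ge> 1" for d
    using that by (intro BH_bound_of_coeff_bound coeff_bound_subexponential) auto
  have upper: "BH d \<le> BH_base powr sqrt (real d * ln (real d))" if "d \<ge> 1" for d
    using bound[OF that] that by (rule BH_bound_BH(1))
  have lower: "1 \<le> BH d" if "d \<ge> 1" for d
    using BH_bound_BH(2)[OF bound[OF that] that] that by (rule BH_bound_ge_1)
  \<comment> \<open>The upper bound becomes \<open>BH_base\<close> to the power
    \<open>sqrt (d ln d) / d\<close>, which tends to \<open>0\<close>; the lower bound is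
    \<open>1\<close>.\<close>
  have "(\<lambda>d. root d (BH d)) \<longlonglongrightarrow> 1"
  proof (rule tendsto_sandwich)
    show "\<forall>\<^sub>F d in sequentially. 1 \<le> root d (BH d)"
      using eventually_ge_at_top[of 1] by eventually_elim (simp add: lower)
    show "\<forall>\<^sub>F d in sequentially. root d (BH d) \<le> BH_base powr (sqrt (real d * ln (real d)) / real d)"
      using eventually_ge_at_top[of 1]
    proof eventually_elim
      case (elim d)
      have "root d (BH d) \<le> root d (BH_base powr sqrt (real d * ln (real d)))"
        using elim upper by (intro real_root_le_mono) auto
      also have "\<dots> = BH_base powr (sqrt (real d * ln (real d)) / real d)"
        using elim by (simp add: root_powr_inverse powr_powr)
      finally show ?case .
    qed
    have "(\<lambda>d. sqrt (real d * ln (real d)) / real d) \<longlonglongrightarrow> 0"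
      by real_asymp
    then have "(\<lambda>d. BH_base powr (sqrt (real d * ln (real d)) / real d)) \<longlonglongrightarrow> BH_base powr 0"
      using BH_base_ge_1 by (intro tendsto_intros) auto
    then show "(\<lambda>d. BH_base powr (sqrt (real d * ln (real d)) / real d)) \<longlonglongrightarrow> 1"
      using BH_base_ge_1 by simp
  qed auto
  then have "limsup (\<lambda>d. ereal (root d (BH d))) = 1"
    by (intro lim_imp_Limsup) (auto simp: one_ereal_def)
  moreover have "BH_base > 0"
    using BH_base_ge_1 by simp
  ultimately show ?thesis
    using upper bound unfolding BH_bound_def coeff_norm_def cube_sup_norm_def by blast
qed

end
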